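(* Let $a<0$, $c<0$, $a_2>0$, $c_2>0$, $b>0$, $b_2>0$, let $0<|\omega|<\min\left\{1,\frac{-a}{b},\frac{-c}{b},\frac{a_2}{b_2},\frac{c_2}{b_2}\right\}$, and let $F:\mathbb{R}^4\to\mathbb{R}$ be $C^2$ with $F(0)=0$ satisfying conditions (a), (b), (c) of the context. Let $(\psi_0,v_0)\in X$ satisfy $P_\omega(\psi_0,v_0)=0$ and $J_\omega(\psi_0,v_0)=S(\omega)$. Then $(\psi_0,v_0)$ is a weak solution of the traveling-wave system, i.e. $J_\omega'(\psi_0,v_0)=0$ in the dual of $X$.
   Context: $X=H^2(\mathbb{R})\times H^2(\mathbb{R})$. For $(\psi,v)\in X$: $I_1(\psi,v)=\int_{\mathbb R}[\psi^2-c(\psi')^2+c_2(\psi'')^2+v^2-a(v')^2+a_2(v'')^2]\,dx$, $I_2(\psi,v)=\int_{\mathbb R}(\psi v+b\psi'v'+b_2\psi''v'')\,dx$, $I_\omega=I_1-2\omega I_2$. $F:\mathbb{R}^4\to\mathbb{R}$ is $C^2$, $F(0)=0$, $G(w)=w\cdot\nabla F(w)$. Conditions: (a) there is $p>0$ with $w\cdot\nabla G(w)\ge(p+2)G(w)$ for all $w\in\mathbb{R}^4$; (b) there exist $0<q_1\le q_2<\infty$, $C>0$ with $|D^2F(w)|\le C(|w|^{q_1}+|w|^{q_2})$; (c) there exist $u,v\in H^2(\mathbb{R})$ with $\int_{\mathbb R}F(u,u',v,v')\,dx>0$. $K(\psi,v)=\int F(\psi,\psi',v,v')\,dx$, $N(\psi,v)=\int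 G(\psi,\psi',v,v')\,dx$, $J_\omega=\tfrac12I_\omega-K$, $P_\omega=I_\omega-N$, $\mathcal M_\omega=\{P_\omega=0\}$, $S(\omega)=\inf\{J_\omega(\psi,v):(\psi,v)\in\mathcal M_\omega\setminus\{0\}\}$. Weak solutions of the traveling-wave equations of the higher-order Boussinesq system (with $b=d$, $b_2=d_2$) are, by definition, critical points of $J_\omega$ on $X$. *)

theory Defs
  imports "HOL-Analysis.Analysis"
begin

text \<open>Test functions: continuously differentiable with compact support
  (weak derivatives tested against C^1_c functions; equivalent to C^\<infinity>_c testing).\<close>
definition test_fun :: "(real \<Rightarrow> real) \<Rightarrow> bool" where
  "test_fun \<phi> \<longleftrightarrow> \<phi> C1_differentiable_on UNIV \<and> bounded {x. \<phi> x \<noteq> 0}"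

definition loc_integrable :: "(real \<Rightarrow> real) \<Rightarrow> bool" where
  "loc_integrable u \<longleftrightarrow> (\<forall>r s. set_integrable lborel {r..s} u)"

definition weak_deriv :: "(real \<Rightarrow> real) \<Rightarrow> (real \<Rightarrow> real) \<Rightarrow> bool" where
  "weak_deriv u u' \<longleftrightarrow> loc_integrable u \<and> loc_integrable u' \<and>
     (\<forall>\<phi>. test_fun \<phi> \<longrightarrow>
        (LINT x|lborel. u x * deriv \<phi> x) = - (LINT x|lborel. u' x * \<phi> x))"

definition sq_int :: "(real \<Rightarrow> real) \<Rightarrow> bool" where
  "sq_int f \<longleftrightarrow> f \<in> borel_measurable lborel \<and> integrable lborel (\<lambda>x. (f x)\<^sup>2)"

definition H2 :: "(real \<Rightarrow> real) \<Rightarrow> bool" where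
  "H2 u \<longleftrightarrow> (\<exists>u1 u2. sq_int u \<and> sq_int u1 \<and> sq_int u2 \<and> weak_deriv u u1 \<and> weak_deriv u1 u2)"

text \<open>A chosen weak derivative (determined up to a.e. equality).\<close>
definition wd :: "(real \<Rightarrow> real) \<Rightarrow> (real \<Rightarrow> real)" where
  "wd u = (SOME u'. weak_deriv u u')"

definition H2_norm_sq :: "(real \<Rightarrow> real) \<Rightarrow> real" where
  "H2_norm_sq u = (LINT x|lborel. (u x)\<^sup>2 + (wd u x)\<^sup>2 + (wd (wd u) x)\<^sup>2)"

definition X_norm :: "(real \<Rightarrow> real) \<Rightarrow> (real \<Rightarrow> real) \<Rightarrow> real" where
  "X_norm \<psi> v = sqrt (H2_norm_sq \<psi> + H2_norm_sq v)"

text \<open>Zero element of X (functions equal a.e. are identified).\<close>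
definition X_zero :: "(real \<Rightarrow> real) \<Rightarrow> (real \<Rightarrow> real) \<Rightarrow> bool" where
  "X_zero \<psi> v \<longleftrightarrow> (AE x in lborel. \<psi> x = 0 \<and> v x = 0)"

definition vec4 :: "real \<Rightarrow> real \<Rightarrow> real \<Rightarrow> real \<Rightarrow> real^4" where
  "vec4 x1 x2 x3 x4 = vector [x1, x2, x3, x4]"

definition grad :: "(real^4 \<Rightarrow> real) \<Rightarrow> real^4 \<Rightarrow> real^4" where
  "grad F w = (\<chi> i. frechet_derivative F (at w) (axis i 1))"

definition hess :: "(real^4 \<Rightarrow> real) \<Rightarrow> real^4 \<Rightarrow> real^4^4" where
  "hess F w = jacobian (grad F) (at w)"

definition C2_R4 :: "(real^4 \<Rightarrow> real) \<Rightarrow> bool" where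
  "C2_R4 F \<longleftrightarrow> (\<forall>w. F differentiable (at w)) \<and> (\<forall>w. grad F differentiable (at w))
     \<and> continuous_on UNIV (hess F)"

definition Gfun :: "(real^4 \<Rightarrow> real) \<Rightarrow> real^4 \<Rightarrow> real" where
  "Gfun F w = w \<bullet> grad F w"

definition I1 :: "real \<Rightarrow> real \<Rightarrow> real \<Rightarrow> real \<Rightarrow> (real \<Rightarrow> real) \<Rightarrow> (real \<Rightarrow> real) \<Rightarrow> real" where
  "I1 a a2 c c2 \<psi> v = (LINT x|lborel. (\<psi> x)\<^sup>2 - c * (wd \<psi> x)\<^sup>2 + c2 * (wd (wd \<psi>) x)\<^sup>2
      + (v x)\<^sup>2 - a * (wd v x)\<^sup>2 + a2 * (wd (wd v) x)\<^sup>2)"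

definition I2 :: "real \<Rightarrow> real \<Rightarrow> (real \<Rightarrow> real) \<Rightarrow> (real \<Rightarrow> real) \<Rightarrow> real" where
  "I2 b b2 \<psi> v = (LINT x|lborel. \<psi> x * v x + b * wd \<psi> x * wd v x + b2 * wd (wd \<psi>) x * wd (wd v) x)"

definition Iw :: "real \<Rightarrow> real \<Rightarrow> real \<Rightarrow> real \<Rightarrow> real \<Rightarrow> real \<Rightarrow> real \<Rightarrow> (real \<Rightarrow> real) \<Rightarrow> (real \<Rightarrow> real) \<Rightarrow> real" where
  "Iw a a2 c c2 b b2 \<omega> \<psi> v = I1 a a2 c c2 \<psi> v - 2 * \<omega> * I2 b b2 \<psi> v"

definition Kfun :: "(real^4 \<Rightarrow> real) \<Rightarrow> (real \<Rightarrow> real) \<Rightarrow> (real \<Rightarrow> real) \<Rightarrow> real" where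
  "Kfun F \<psi> v = (LINT x|lborel. F (vec4 (\<psi> x) (wd \<psi> x) (v x) (wd v x)))"

definition Nfun :: "(real^4 \<Rightarrow> real) \<Rightarrow> (real \<Rightarrow> real) \<Rightarrow> (real \<Rightarrow> real) \<Rightarrow> real" where
  "Nfun F \<psi> v = (LINT x|lborel. Gfun F (vec4 (\<psi> x) (wd \<psi> x) (v x) (wd v x)))"

definition Jw where
  "Jw a a2 c c2 b b2 \<omega> F \<psi> v = Iw a a2 c c2 b b2 \<omega> \<psi> v / 2 - Kfun F \<psi> v"

definition Pw where
  "Pw a a2 c c2 b b2 \<omega> F \<psi> v = Iw a a2 c c2 b b2 \<omega> \<psi> v - Nfun F \<psi> v"

definition Sw where
  "Sw a a2 c c2 b b2 \<omega> F = Inf {Jw a a2 c c2 b b2 \<omega> F \<psi> v | \<psi> v.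
      H2 \<psi> \<and> H2 v \<and> Pw a a2 c c2 b b2 \<omega> F \<psi> v = 0 \<and> \<not> X_zero \<psi> v}"

definition Jw_critical where
  "Jw_critical a a2 c c2 b b2 \<omega> F \<psi>0 v0 \<longleftrightarrow>
     (\<forall>\<epsilon>>0. \<exists>\<delta>>0. \<forall>h k. H2 h \<and> H2 k \<and> X_norm h k < \<delta> \<longrightarrow>
        \<bar>Jw a a2 c c2 b b2 \<omega> F (\<lambda>x. \<psi>0 x + h x) (\<lambda>x. v0 x + k x) - Jw a a2 c c2 b b2 \<omega> F \<psi>0 v0\<bar>
          \<le> \<epsilon> * X_norm h k)"

end

(* Write J for the functional and P for the Nehari constraint. Condition (a) gives
   G(tw) >= t^(p+2) G(w) for t >= 1. Hence on the ray through a nonzero z with P(z) = 0 the sign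
   of P changes from + to - at z, and J restricted to the ray is maximal at z; moreover J >= 0 on
   the Nehari manifold. If J'(z) were negative in some direction y, then for small s > 0 the
   intermediate value theorem yields t close to 1 with P(t(z + s y)) = 0, and
   J(t(z + s y)) < J(t z) <= J(z), contradicting minimality. So no Lagrange multiplier is needed.
   The functional is differentiable on X because functions in H^1 of the line are essentially
   bounded, so the Lipschitz bounds for the gradient of F on balls suffice. *)

theory Submission
  imports Defs
begin

section \<open>Weak derivatives and the Sobolev bound\<close>

text \<open>\<open>Jw_critical\<close> demands an increment of smaller order than
  \<open>X_norm\<close>, so vanishing directional derivatives do not suffice; a remainder quadratic
  in the norm, uniform over perturbations of norm below 1, is needed too. The argument runs on jets:
  a pair in X becomes one map into R^4 x R^2, and J, P and the derivative of J become integrals of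
  pointwise densities. The split records what is bounded: the arguments of F are essentially
  bounded, the second derivatives are only square integrable and enter only the quadratic form.
  Since \<open>wd\<close> is a chosen weak derivative, identities between jets hold almost
  everywhere. The sup bound is obtained by duality, from pairings with nonnegative bumps, without a
  continuous representative. In the descent step the order of choices matters: the range of t around
  1 is fixed first, so small that the derivative at z still governs a step taken from tz; only then
  is s shrunk until the signs of P at both ends of that range survive the perturbation. The
  assumptions on the pair allow it to be zero; that case rests on the vanishing of the gradient of F
  at 0, itself a consequence of (a).\<close>

lemma continuous_antiderivative:
  fixes g :: "real \<Rightarrow> real"
  assumes "continuous_on UNIV g"
  obtains \<Phi> where "\<And>x. (\<Phi> has_real_derivative g x) (at x)"
proof -
  have "\<exists>F. \<forall>x::real. -\<infinity> < ereal x \<longrightarrow> ereal x < \<infinity> \<longrightarrow> (F has_vector_derivative g x) (at x)"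
    using assms by (intro einterval_antiderivative) (auto simp: continuous_on_eq_continuous_at)
  then show thesis
    using that by (auto simp: has_real_derivative_iff_has_vector_derivative)
qed

section \<open>Test functions and local integrability\<close>

lemma test_funI:
  assumes "\<And>x. (\<phi> has_real_derivative \<phi>' x) (at x)" "continuous_on UNIV \<phi>'"
    and "\<And>x. x \<notin> B \<Longrightarrow> \<phi> x = 0" "bounded B"
  shows "test_fun \<phi>"
proof -
  have "{x. \<phi> x \<noteq> 0} \<subseteq> B"
    using assms(3) by auto
  then have "bounded {x. \<phi> x \<noteq> 0}"
    using assms(4) bounded_subset by blast
  then show ?thesis
    using assms(1,2) unfolding test_fun_def C1_differentiable_on_def
    by (auto simp: has_real_derivative_iff_has_vector_derivative)
qed

lemma test_fun_DERIV:
  assumes "test_fun \<phi>"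
  shows "(\<phi> has_real_derivative deriv \<phi> x) (at x)"
proof -
  obtain D where "(\<phi> has_real_derivative D) (at x)"
    using assms unfolding test_fun_def C1_differentiable_on_def
    by (auto simp: has_real_derivative_iff_has_vector_derivative)
  then show ?thesis
    using DERIV_imp_deriv by metis
qed

lemma test_fun_continuous:
  assumes "test_fun \<phi>"
  shows "continuous_on UNIV \<phi>" "continuous_on UNIV (deriv \<phi>)"
proof -
  show "continuous_on UNIV \<phi>"
    using test_fun_DERIV[OF assms] DERIV_isCont continuous_at_imp_continuous_on by blast
  obtain D where D: "continuous_on UNIV D" "\<And>x. (\<phi> has_vector_derivative D x) (at x)"
    using assms unfolding test_fun_def C1_differentiable_on_def by auto
  then have "deriv \<phi> = D"
    by (auto intro!: ext DERIV_imp_deriv simp: has_real_derivative_iff_has_vector_derivative)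
  with D show "continuous_on UNIV (deriv \<phi>)"
    by simp
qed

lemma test_fun_support:
  assumes "test_fun \<phi>"
  obtains R where "R > 0" "\<And>x. \<bar>x\<bar> \<ge> R \<Longrightarrow> \<phi> x = 0" "\<And>x. \<bar>x\<bar> \<ge> R \<Longrightarrow> deriv \<phi> x = 0"
proof -
  obtain R where R: "R > 0" "\<And>x. \<phi> x \<noteq> 0 \<Longrightarrow> \<bar>x\<bar> \<le> R"
    using assms unfolding test_fun_def bounded_pos by auto
  have z: "\<phi> x = 0" if "\<bar>x\<bar> > R" for x
    using R(2)[of x] that by force
  have "deriv \<phi> x = 0" if "\<bar>x\<bar> > R" for x
  proof (rule DERIV_imp_deriv)
    have "open {x::real. \<bar>x\<bar> > R}"
      by (intro open_Collect_less continuous_intros)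
    then show "(\<phi> has_field_derivative 0) (at x)"
      by (rule has_field_derivative_transform_within_open[OF DERIV_const[of 0]])
        (use that z in auto)
  qed
  \<comment> \<open>The derivative is known to vanish only on the open set
    \<open>\<bar>x\<bar> > R\<close>; enlarging the radius by 1 makes the bound non-strict.\<close>
  with R z show thesis
    by (intro that[of "R + 1"]) (simp_all add: less_le_trans[of R "R + 1"])
qed

lemma loc_integrable_mult:
  assumes f: "loc_integrable f" and g: "continuous_on UNIV g"
    and R: "\<And>x. \<bar>x\<bar> \<ge> R \<Longrightarrow> g x = 0"
  shows "integrable lborel (\<lambda>x. f x * g x)"
proof -
  have "set_integrable lborel {-R..R} f"
    using f by (simp add: loc_integrable_def)
  then have *: "integrable lborel (\<lambda>x. indicator {-R..R} x * f x)"
    by (simp add: set_integrable_def)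
  have "bounded (g ` {-R..R})"
    by (intro compact_imp_bounded compact_continuous_image continuous_on_subset[OF g]) auto
  then obtain B where B: "\<And>x. x \<in> {-R..R} \<Longrightarrow> \<bar>g x\<bar> \<le> B" "B > 0"
    unfolding bounded_pos by force
  have gm: "g \<in> borel_measurable lborel"
    using g borel_measurable_continuous_onI by simp
  have "integrable lborel (\<lambda>x. (indicator {-R..R} x * f x) * g x)"
  proof (rule Bochner_Integration.integrable_bound)
    show "integrable lborel (\<lambda>x. B * (indicator {-R..R} x * f x))"
      using * by simp
    show "(\<lambda>x. (indicator {-R..R} x * f x) * g x) \<in> borel_measurable lborel"
      using borel_measurable_integrable[OF *] gm by (rule borel_measurable_times)
    show "AE x in lborel. norm ((indicator {-R..R} x * f x) * g x)
        \<le> norm (B * (indicator {-R..R} x * f x))"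
      using B by (auto simp: abs_mult indicator_def mult.commute[of B] intro!: AE_I2 mult_left_mono)
  qed
  also have "(\<lambda>x. (indicator {-R..R} x * f x) * g x) = (\<lambda>x. f x * g x)"
  proof
    fix x
    show "indicator {-R..R} x * f x * g x = f x * g x"
      using R[of x] by (cases "\<bar>x\<bar> \<ge> R") (auto simp: indicator_def)
  qed
  finally show ?thesis .
qed

lemma loc_integrable_test:
  assumes "loc_integrable f" "test_fun \<phi>"
  shows "integrable lborel (\<lambda>x. f x * \<phi> x)" "integrable lborel (\<lambda>x. f x * deriv \<phi> x)"
proof -
  obtain R where R: "R > 0" "\<And>x. \<bar>x\<bar> \<ge> R \<Longrightarrow> \<phi> x = 0" "\<And>x. \<bar>x\<bar> \<ge> R \<Longrightarrow> deriv \<phi> x = 0"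
    using test_fun_support[OF assms(2)] by blast
  show "integrable lborel (\<lambda>x. f x * \<phi> x)" "integrable lborel (\<lambda>x. f x * deriv \<phi> x)"
    using R test_fun_continuous[OF assms(2)] by (auto intro!: loc_integrable_mult[OF assms(1)])
qed

lemma loc_integrable_borel:
  assumes "loc_integrable f"
  shows "f \<in> borel_measurable lborel"
proof (rule borel_measurable_LIMSEQ_metric)
  show "(\<lambda>x. indicator {-real n..real n} x *\<^sub>R f x) \<in> borel_measurable lborel" for n
    using assms unfolding loc_integrable_def set_integrable_def
    by (intro borel_measurable_integrable) blast
  show "(\<lambda>n. indicator {-real n..real n} x *\<^sub>R f x) \<longlonglongrightarrow> f x" for x
  proof (rule tendsto_eventually)
    obtain N where "\<bar>x\<bar> \<le> real N"
      using real_arch_simple by blast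
    then show "\<forall>\<^sub>F n in sequentially. indicator {-real n..real n} x *\<^sub>R f x = f x"
      by (intro eventually_sequentiallyI[of N]) (auto simp: indicator_def abs_le_iff)
  qed
qed

lemma sq_int_loc_integrable:
  assumes "sq_int f"
  shows "loc_integrable f"
  unfolding loc_integrable_def set_integrable_def
proof (intro allI)
  fix r s :: real
  show "integrable lborel (\<lambda>x. indicator {r..s} x *\<^sub>R f x)"
  proof (rule Bochner_Integration.integrable_bound)
    show "integrable lborel (\<lambda>x. indicator {r..s} x *\<^sub>R 1 + (f x)\<^sup>2)"
      using assms unfolding sq_int_def
      by (intro Bochner_Integration.integrable_add integrable_scaleR_left integrable_real_indicator)
        (auto simp: emeasure_lborel_Icc_eq)
    show "(\<lambda>x. indicator {r..s} x *\<^sub>R f x) \<in> borel_measurable lborel"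
      using assms unfolding sq_int_def by auto
    have "\<bar>y\<bar> \<le> 1 + y\<^sup>2" for y :: real
      using zero_le_power2[of "\<bar>y\<bar> - 1/2"] by (simp add: power2_eq_square algebra_simps)
    then show "AE x in lborel. norm (indicator {r..s} x *\<^sub>R f x)
        \<le> norm (indicator {r..s} x *\<^sub>R 1 + (f x)\<^sup>2)"
      by (auto simp: indicator_def intro!: AE_I2)
  qed
qed

text \<open>Averaging the continuous cutoff over windows of length \<open>\<delta>\<close> makes it continuously
  differentiable; by the mean value theorem each average is still a value of the original.\<close>

lemma C1_cutoff:
  fixes K :: "real set"
  assumes K: "compact K" "K \<noteq> {}" and d: "d > 0"
  obtains \<phi> where "test_fun \<phi>" "\<And>x. 0 \<le> \<phi> x" "\<And>x. \<phi> x \<le> 1" "\<And>x. x \<in> K \<Longrightarrow> \<phi> x = 1"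
    "\<And>x. infdist x K \<ge> d \<Longrightarrow> \<phi> x = 0"
proof -
  \<comment> \<open>One third of \<open>d\<close> is the plateau of \<open>g\<close> around
    \<open>K\<close>, one third its slope, and one third is lost to the averaging window.\<close>
  define \<delta> where "\<delta> = d / 3"
  have \<delta>: "\<delta> > 0" "d = 3 * \<delta>"
    using d by (auto simp: \<delta>_def)
  define g where "g t = max 0 (min 1 (2 - infdist t K / \<delta>))" for t
  have gc: "continuous_on UNIV g"
    unfolding g_def by (intro continuous_intros) (use \<delta> in auto)
  obtain \<Phi> where \<Phi>: "\<And>x. (\<Phi> has_real_derivative g x) (at x)"
    using continuous_antiderivative[OF gc] by blast
  define \<phi> where "\<phi> x = (\<Phi> (x + \<delta>) - \<Phi> x) / \<delta>" for x
  have val: "\<exists>\<xi>. x < \<xi> \<and> \<xi> < x + \<delta> \<and> \<phi> x = g \<xi>" for x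
  proof -
    obtain \<xi> where "x < \<xi>" "\<xi> < x + \<delta>" "\<Phi> (x + \<delta>) - \<Phi> x = (x + \<delta> - x) * g \<xi>"
      using MVT2[of x "x + \<delta>" \<Phi> g] \<Phi> \<delta> by auto
    with \<delta> show ?thesis
      by (auto simp: \<phi>_def)
  qed
  have far: "\<phi> x = 0" if "infdist x K \<ge> d" for x
  proof -
    obtain \<xi> where \<xi>: "x < \<xi>" "\<xi> < x + \<delta>" "\<phi> x = g \<xi>"
      using val by blast
    have "2 * \<delta> \<le> infdist \<xi> K"
      using infdist_triangle[of x K \<xi>] that \<xi> \<delta> by (auto simp: dist_real_def)
    then have "2 - infdist \<xi> K / \<delta> \<le> 0"
      using \<delta> by (simp add: field_simps)
    with \<xi> show ?thesis
      by (simp add: g_def)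
  qed
  show thesis
  proof (rule that)
    show "test_fun \<phi>"
    proof (rule test_funI)
      show "(\<phi> has_real_derivative (g (x + \<delta>) - g x) / \<delta>) (at x)" for x
        unfolding \<phi>_def
        by (intro DERIV_cdivide DERIV_diff \<Phi>) (use \<Phi> in \<open>simp add: DERIV_shift[symmetric]\<close>)
      show "continuous_on UNIV (\<lambda>x. (g (x + \<delta>) - g x) / \<delta>)"
        by (intro continuous_intros continuous_on_compose2[OF gc]) (use \<delta> in auto)
      show "\<phi> x = 0" if "x \<notin> (\<Union>k\<in>K. cball k d)" for x
      proof (rule far, rule ccontr)
        assume "\<not> d \<le> infdist x K"
        moreover obtain k where "k \<in> K" "infdist x K = dist x k"
          using infdist_attains_inf[OF compact_imp_closed[OF K(1)] K(2)] by blast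
        ultimately show False
          using that by (auto simp: dist_commute)
      qed
      obtain R where "\<And>k. k \<in> K \<Longrightarrow> \<bar>k\<bar> \<le> R"
        using compact_imp_bounded[OF K(1)] unfolding bounded_iff by auto
      then have "(\<Union>k\<in>K. cball k d) \<subseteq> cball 0 (R + d)"
        by (force simp: dist_real_def)
      then show "bounded (\<Union>k\<in>K. cball k d)"
        using bounded_subset bounded_cball by blast
    qed
    show "0 \<le> \<phi> x" "\<phi> x \<le> 1" for x
      using val[of x] by (auto simp: g_def)
    show "\<phi> x = 1" if "x \<in> K" for x
    proof -
      obtain \<xi> where \<xi>: "x < \<xi>" "\<xi> < x + \<delta>" "\<phi> x = g \<xi>"
        using val by blast
      have "infdist \<xi> K \<le> \<delta>"
        using infdist_le[OF that, of \<xi>] \<xi> by (auto simp: dist_real_def)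
      then have "infdist \<xi> K / \<delta> \<le> 1"
        using \<delta> by simp
      with \<xi> show ?thesis
        by (simp add: g_def)
    qed
  qed (use far in auto)
qed

text \<open>Localised form of the fundamental lemma of the calculus of variations. If
  \<open>f\<close> were negative on a non-null part of \<open>S\<close>, inner regularity would give
  a non-null compact \<open>K\<close> there; cutoffs shrinking to \<open>K\<close> make the integral
  of \<open>f\<close> over \<open>K\<close> nonnegative, although the integrand is negative on
  \<open>K\<close>.\<close>

lemma AE_nonneg_if_test:
  fixes f :: "real \<Rightarrow> real"
  assumes f: "loc_integrable f" and S: "open S"
    and pos: "\<And>\<phi>. test_fun \<phi> \<Longrightarrow> (\<And>x. 0 \<le> \<phi> x) \<Longrightarrow> (\<And>x. x \<notin> S \<Longrightarrow> \<phi> x = 0)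
      \<Longrightarrow> 0 \<le> (LINT x|lborel. f x * \<phi> x)"
  shows "AE x in lborel. x \<in> S \<longrightarrow> 0 \<le> f x"
proof -
  have [measurable]: "f \<in> borel_measurable borel"
    using loc_integrable_borel[OF f] by simp
  have [measurable]: "S \<in> sets borel"
    using S by simp
  have compact_null: "emeasure lborel K = 0"
    if K: "compact K" "K \<subseteq> S" "\<And>x. x \<in> K \<Longrightarrow> f x < 0" for K
  proof (cases "K = {}")
    case False
    obtain d where d: "d > 0" "\<And>x y. x \<in> K \<Longrightarrow> y \<notin> S \<Longrightarrow> d \<le> dist x y"
      using separate_compact_closed[of K "-S"] K S
      by (metis Compl_iff closed_Compl disjoint_eq_subset_Compl double_complement)
    \<comment> \<open>Cutoff widths: never above \<open>d\<close>, so every cutoff vanishes off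
      \<open>S\<close>, and tending to 0, so the cutoffs converge to the indicator of
      \<open>K\<close>.\<close>
    define e where "e n = d / (real n + 1)" for n
    have e: "0 < e n" "e n \<le> d" for n
      using d by (auto simp: e_def field_simps)
    have "\<exists>\<phi>. test_fun \<phi> \<and> (\<forall>x. 0 \<le> \<phi> x) \<and> (\<forall>x. \<phi> x \<le> 1) \<and> (\<forall>x\<in>K. \<phi> x = 1)
        \<and> (\<forall>x. infdist x K \<ge> e n \<longrightarrow> \<phi> x = 0)" for n
      using C1_cutoff[OF K(1) False e(1)] by metis
    then obtain \<phi> where \<phi>: "\<And>n. test_fun (\<phi> n)" "\<And>n x. 0 \<le> \<phi> n x" "\<And>n x. \<phi> n x \<le> 1"
      "\<And>n x. x \<in> K \<Longrightarrow> \<phi> n x = 1" "\<And>n x. infdist x K \<ge> e n \<Longrightarrow> \<phi> n x = 0"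
      by metis
    obtain R where R: "\<And>k. k \<in> K \<Longrightarrow> \<bar>k\<bar> \<le> R"
      using compact_imp_bounded[OF K(1)] unfolding bounded_iff by auto
    have attain: "\<exists>k\<in>K. infdist x K = dist x k" for x
      using infdist_attains_inf[OF compact_imp_closed[OF K(1)] False] by metis
    have KS: "\<phi> n x = 0" if "x \<notin> S" for n x
    proof (rule \<phi>(5))
      obtain k where "k \<in> K" "infdist x K = dist x k"
        using attain by blast
      then show "e n \<le> infdist x K"
        using d(2)[of k x] that e(2)[of n] by (simp add: dist_commute)
    qed
    have KR: "\<phi> n x = 0" if "\<bar>x\<bar> > R + d" for n x
    proof (rule \<phi>(5))
      obtain k where "k \<in> K" "infdist x K = dist x k"
        using attain by blast
      then show "e n \<le> infdist x K"
        using R[of k] that e(2)[of n] by (auto simp: dist_real_def)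
    qed
    have Kb [measurable]: "K \<in> sets borel"
      using K(1) borel_compact by blast
    have loc: "integrable lborel (\<lambda>x. indicator {-(R+d)..R+d} x *\<^sub>R f x)"
      using f unfolding loc_integrable_def set_integrable_def by blast
    have phib: "\<phi> n \<in> borel_measurable borel" for n
      using test_fun_continuous[OF \<phi>(1)] borel_measurable_continuous_onI by blast
    have lim: "(\<lambda>n. LINT x|lborel. f x * \<phi> n x) \<longlonglongrightarrow> (LINT x|lborel. f x * indicator K x)"
    proof (rule integral_dominated_convergence)
      show "integrable lborel (\<lambda>x. norm (indicator {-(R+d)..R+d} x *\<^sub>R f x))"
        using loc by (rule integrable_norm)
      show "AE x in lborel. norm (f x * \<phi> n x) \<le> norm (indicator {-(R+d)..R+d} x *\<^sub>R f x)" for n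
      proof (rule AE_I2)
        fix x
        show "norm (f x * \<phi> n x) \<le> norm (indicator {-(R+d)..R+d} x *\<^sub>R f x)"
          using KR[of x n] \<phi>(2,3)[of n x]
          by (cases "\<bar>x\<bar> > R + d") (auto simp: indicator_def abs_mult mult_left_le)
      qed
      show "AE x in lborel. (\<lambda>n. f x * \<phi> n x) \<longlonglongrightarrow> f x * indicator K x"
      proof (rule AE_I2)
        fix x
        have "(\<lambda>n. \<phi> n x) \<longlonglongrightarrow> indicator K x"
        proof (cases "x \<in> K")
          case True
          then show ?thesis
            using \<phi>(4) by simp
        next
          case out: False
          then have "infdist x K > 0"
            using K(1) False by (simp add: compact_imp_closed infdist_pos_not_in_closed)
          moreover have "e \<longlonglongrightarrow> 0"
            using tendsto_mult[OF tendsto_const[of d] LIMSEQ_inverse_real_of_nat]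
            by (simp add: e_def[abs_def] divide_inverse add.commute)
          ultimately have "\<forall>\<^sub>F n in sequentially. e n < infdist x K"
            using order_tendstoD(2) by blast
          then have "\<forall>\<^sub>F n in sequentially. \<phi> n x = 0"
            by eventually_elim (use \<phi>(5) in auto)
          with out show ?thesis
            by (simp add: tendsto_eventually)
        qed
        then show "(\<lambda>n. f x * \<phi> n x) \<longlonglongrightarrow> f x * indicator K x"
          by (intro tendsto_intros)
      qed
    qed (use phib in auto)
    have "0 \<le> (LINT x|lborel. f x * indicator K x)"
      using lim by (rule LIMSEQ_le_const) (use pos[OF \<phi>(1)] \<phi>(2) KS in auto)
    moreover have int: "integrable lborel (\<lambda>x. - (f x * indicator K x))"
    proof (rule Bochner_Integration.integrable_bound[OF loc])
      show "AE x in lborel. norm (- (f x * indicator K x)) \<le> norm (indicator {-(R+d)..R+d} x *\<^sub>R f x)"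
        using R d by (intro AE_I2) (fastforce simp: indicator_def)
    qed auto
    moreover have nn: "AE x in lborel. 0 \<le> - (f x * indicator K x)"
      using K(3) by (auto simp: indicator_def intro!: AE_I2 less_imp_le)
    ultimately have "(LINT x|lborel. - (f x * indicator K x)) = 0"
      using integral_nonneg_AE[OF nn] by simp
    then have "AE x in lborel. - (f x * indicator K x) = 0"
      using integral_nonneg_eq_0_iff_AE[OF int nn] by simp
    then have "AE x in lborel. x \<notin> K"
      by eventually_elim (use K(3) in \<open>force simp: indicator_def\<close>)
    then show ?thesis
      by (subst (asm) AE_iff_measurable[where N=K]) auto
  qed auto
  \<comment> \<open>Truncation makes the measure finite and turns closed subsets into compact
    ones.\<close>
  define A where "A n = {x \<in> S. f x < 0} \<inter> {-real n..real n}" for n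
  have Ab [measurable]: "A n \<in> sets borel" for n
    unfolding A_def by measurable
  have "emeasure lborel (A n) = 0" for n
  proof (rule ccontr)
    assume ne: "emeasure lborel (A n) \<noteq> 0"
    have "emeasure lborel (A n) \<le> emeasure lborel {-real n..real n}"
      by (intro emeasure_mono) (auto simp: A_def)
    also have "\<dots> < \<infinity>"
      by simp
    finally have fin: "emeasure lborel (A n) < \<infinity>" .
    define m where "m = measure lborel (A n)"
    have m: "emeasure lborel (A n) = ennreal m" "m > 0"
      using fin ne unfolding m_def
      by (auto simp: emeasure_eq_ennreal_measure less_top zero_less_measure_iff)
    \<comment> \<open>The tolerance is the whole measure \<open>m\<close>: a null \<open>T\<close>
      would leave all of \<open>m\<close> in \<open>A n - T\<close>, contradicting the strict
      inequality.\<close>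
    obtain T where T: "closed T" "T \<subseteq> A n" "emeasure lebesgue (A n - T) < ennreal m"
      using sets_lebesgue_inner_closed[of "A n" m] m(2) Ab by (metis lborelD sets_completionI_sets sets_lborel)
    have "bounded (A n)"
      unfolding A_def using bounded_subset[OF bounded_closed_interval] by blast
    then have "compact T"
      using T bounded_subset compact_eq_bounded_closed by blast
    then have "emeasure lborel T = 0"
      using compact_null T(2) by (auto simp: A_def subset_iff)
    moreover have "A n = (A n - T) \<union> T"
      using T by auto
    moreover have Tb: "T \<in> sets borel"
      using T by simp
    ultimately have "emeasure lborel (A n) \<le> emeasure lborel (A n - T)"
      using emeasure_subadditive[of "A n - T" lborel T] Ab by simp
    also have "\<dots> < ennreal m"
      using T(3) Tb Ab by simp
    finally show False
      using m by simp
  qed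
  then have "AE x in lborel. x \<notin> A n" for n
    by (intro AE_not_in null_setsI) auto
  then have "AE x in lborel. \<forall>n. x \<notin> A n"
    by (simp add: AE_all_countable)
  then show ?thesis
  proof eventually_elim
    case (elim x)
    obtain n where "\<bar>x\<bar> \<le> real n"
      using real_arch_simple by blast
    with elim[rule_format, of n] show ?case
      by (auto simp: A_def abs_le_iff)
  qed
qed

lemma loc_integrable_lincomb:
  assumes "loc_integrable f" "loc_integrable g"
  shows "loc_integrable (\<lambda>x. \<alpha> * f x + \<beta> * g x)"
  using assms unfolding loc_integrable_def
  by (intro allI set_integral_add(1) set_integrable_mult_right impI) blast+

lemma loc_integrable_cong_AE:
  assumes "loc_integrable f" "g \<in> borel_measurable lborel" "AE x in lborel. f x = g x"
  shows "loc_integrable g"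
  unfolding loc_integrable_def
proof (intro allI)
  fix r s
  have "set_integrable lborel {r..s} f"
    using assms(1) unfolding loc_integrable_def by blast
  moreover have "AE x in lborel. indicator {r..s} x *\<^sub>R f x = indicator {r..s} x *\<^sub>R g x"
    using assms(3) by eventually_elim simp
  ultimately show "set_integrable lborel {r..s} g"
    unfolding set_integrable_def using assms(2)
    by (intro integrable_cong_AE_imp[of lborel "\<lambda>x. indicator {r..s} x *\<^sub>R f x"
          "\<lambda>x. indicator {r..s} x *\<^sub>R g x"]) simp_all
qed

lemma AE_eq_0_if_test:
  assumes f: "loc_integrable f"
    and zero: "\<And>\<phi>. test_fun \<phi> \<Longrightarrow> (LINT x|lborel. f x * \<phi> x) = 0"
  shows "AE x in lborel. f x = 0"
proof -
  have "AE x in lborel. x \<in> UNIV \<longrightarrow> 0 \<le> f x"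
    by (rule AE_nonneg_if_test) (use f zero in auto)
  moreover have "AE x in lborel. x \<in> UNIV \<longrightarrow> 0 \<le> - f x"
  proof (rule AE_nonneg_if_test)
    show "loc_integrable (\<lambda>x. - f x)"
      using loc_integrable_lincomb[OF f f, of "-1" 0] by simp
  qed (use zero in auto)
  ultimately show ?thesis
    by eventually_elim auto
qed

section \<open>Calculus of weak derivatives and of the chosen derivative \<open>wd\<close>\<close>

lemma weak_deriv_borel:
  assumes "weak_deriv u u1"
  shows "u \<in> borel_measurable borel" "u1 \<in> borel_measurable borel"
  using assms loc_integrable_borel unfolding weak_deriv_def by auto

text \<open>This makes the arbitrary choice in \<open>wd\<close> harmless: every integral built from
  \<open>wd\<close> is independent of it.\<close>

lemma weak_deriv_unique:
  assumes "weak_deriv u u1" "weak_deriv u u2"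
  shows "AE x in lborel. u1 x = u2 x"
proof -
  have l: "loc_integrable u1" "loc_integrable u2"
    using assms by (auto simp: weak_deriv_def)
  have "AE x in lborel. 1 * u1 x + (-1) * u2 x = 0"
  proof (rule AE_eq_0_if_test)
    show "loc_integrable (\<lambda>x. 1 * u1 x + (-1) * u2 x)"
      using l by (rule loc_integrable_lincomb)
    fix \<phi> assume \<phi>: "test_fun \<phi>"
    have "(LINT x|lborel. u1 x * \<phi> x) = (LINT x|lborel. u2 x * \<phi> x)"
      using assms \<phi> unfolding weak_deriv_def by fastforce
    then show "(LINT x|lborel. (1 * u1 x + (-1) * u2 x) * \<phi> x) = 0"
      using loc_integrable_test(1)[OF l(1) \<phi>] loc_integrable_test(1)[OF l(2) \<phi>]
      by (simp add: left_diff_distrib)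
  qed
  then show ?thesis
    by simp
qed

text \<open>Used to pass a second weak derivative from some \<open>u1\<close> to
  \<open>wd u\<close>, which agrees with it only almost everywhere. Measurability of
  \<open>w\<close> is a separate assumption because \<open>lborel\<close> is not complete.\<close>

lemma weak_deriv_cong_AE:
  assumes "weak_deriv u u1" "AE x in lborel. u x = w x" "w \<in> borel_measurable lborel"
  shows "weak_deriv w u1"
proof -
  have u: "loc_integrable u"
    using assms by (auto simp: weak_deriv_def)
  then have w: "loc_integrable w"
    using assms loc_integrable_cong_AE by blast
  have "(LINT x|lborel. u x * deriv \<phi> x) = (LINT x|lborel. w x * deriv \<phi> x)"
    if "test_fun \<phi>" for \<phi>
    using assms(2) borel_measurable_integrable[OF loc_integrable_test(2)[OF u that]]
      borel_measurable_integrable[OF loc_integrable_test(2)[OF w that]]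
    by (intro integral_cong_AE) auto
  then show ?thesis
    using assms(1) w unfolding weak_deriv_def by auto
qed

lemma weak_deriv_lincomb:
  assumes "weak_deriv u u1" "weak_deriv v v1"
  shows "weak_deriv (\<lambda>x. \<alpha> * u x + \<beta> * v x) (\<lambda>x. \<alpha> * u1 x + \<beta> * v1 x)"
proof -
  have l: "loc_integrable u" "loc_integrable u1" "loc_integrable v" "loc_integrable v1"
    using assms by (auto simp: weak_deriv_def)
  have "(LINT x|lborel. (\<alpha> * u x + \<beta> * v x) * deriv \<phi> x)
      = - (LINT x|lborel. (\<alpha> * u1 x + \<beta> * v1 x) * \<phi> x)" if \<phi>: "test_fun \<phi>" for \<phi>
  proof -
    note i = loc_integrable_test[OF _ \<phi>]
    have "(LINT x|lborel. (\<alpha> * u x + \<beta> * v x) * deriv \<phi> x)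
        = \<alpha> * (LINT x|lborel. u x * deriv \<phi> x) + \<beta> * (LINT x|lborel. v x * deriv \<phi> x)"
      using i(2)[OF l(1)] i(2)[OF l(3)] by (simp add: distrib_right mult.assoc)
    moreover have "(LINT x|lborel. (\<alpha> * u1 x + \<beta> * v1 x) * \<phi> x)
        = \<alpha> * (LINT x|lborel. u1 x * \<phi> x) + \<beta> * (LINT x|lborel. v1 x * \<phi> x)"
      using i(1)[OF l(2)] i(1)[OF l(4)] by (simp add: distrib_right mult.assoc)
    ultimately show ?thesis
      using assms \<phi> unfolding weak_deriv_def by simp
  qed
  then show ?thesis
    using l loc_integrable_lincomb unfolding weak_deriv_def by blast
qed

lemma wd_AE_eq:
  assumes "weak_deriv u u1"
  shows "weak_deriv u (wd u)" "AE x in lborel. wd u x = u1 x"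
proof -
  show "weak_deriv u (wd u)"
    unfolding wd_def using assms by (rule someI[of "weak_deriv u"])
  then show "AE x in lborel. wd u x = u1 x"
    using assms weak_deriv_unique by blast
qed

lemma sq_int_cong_AE:
  assumes "sq_int f" "AE x in lborel. g x = f x" "g \<in> borel_measurable lborel"
  shows "sq_int g"
proof -
  have "integrable lborel (\<lambda>x. (g x)\<^sup>2)"
  proof (rule integrable_cong_AE_imp)
    show "integrable lborel (\<lambda>x. (f x)\<^sup>2)"
      using assms by (simp add: sq_int_def)
    show "AE x in lborel. (f x)\<^sup>2 = (g x)\<^sup>2"
      using assms(2) by eventually_elim simp
  qed (use assms in auto)
  with assms show ?thesis
    by (simp add: sq_int_def)
qed

lemma sq_int_lincomb:
  assumes "sq_int f" "sq_int g"
  shows "sq_int (\<lambda>x. \<alpha> * f x + \<beta> * g x)"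
proof -
  have [measurable]: "f \<in> borel_measurable borel" "g \<in> borel_measurable borel"
    using assms by (auto simp: sq_int_def)
  have "integrable lborel (\<lambda>x. (\<alpha> * f x + \<beta> * g x)\<^sup>2)"
  proof (rule Bochner_Integration.integrable_bound)
    show "integrable lborel (\<lambda>x. 2 * \<alpha>\<^sup>2 * (f x)\<^sup>2 + 2 * \<beta>\<^sup>2 * (g x)\<^sup>2)"
      using assms unfolding sq_int_def by auto
    have "(s + t)\<^sup>2 \<le> 2 * s\<^sup>2 + 2 * t\<^sup>2" for s t :: real
      using zero_le_power2[of "s - t"] by (simp add: power2_eq_square algebra_simps)
    from this[of "\<alpha> * f x" "\<beta> * g x" for x]
    show "AE x in lborel. norm ((\<alpha> * f x + \<beta> * g x)\<^sup>2)
        \<le> norm (2 * \<alpha>\<^sup>2 * (f x)\<^sup>2 + 2 * \<beta>\<^sup>2 * (g x)\<^sup>2)"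
      by (intro AE_I2) (simp add: power_mult_distrib mult.assoc)
  qed simp
  then show ?thesis
    by (simp add: sq_int_def)
qed

text \<open>\<open>H2\<close> only provides some \<open>u1\<close> and \<open>u2\<close>. The chosen
  \<open>wd u\<close> equals \<open>u1\<close> almost everywhere, hence inherits \<open>u2\<close>
  as weak derivative, and only then is the choice in \<open>wd (wd u)\<close> known to be a genuine
  derivative.\<close>

lemma H2D:
  assumes "H2 u"
  shows "sq_int u" "sq_int (wd u)" "sq_int (wd (wd u))"
    and "weak_deriv u (wd u)" "weak_deriv (wd u) (wd (wd u))"
proof -
  obtain u1 u2 where u: "sq_int u" "sq_int u1" "sq_int u2" "weak_deriv u u1" "weak_deriv u1 u2"
    using assms unfolding H2_def by blast
  have 1: "weak_deriv u (wd u)" "AE x in lborel. wd u x = u1 x"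
    using wd_AE_eq[OF u(4)] by auto
  have m: "wd u \<in> borel_measurable lborel"
    using weak_deriv_borel[OF 1(1)] by simp
  have "AE x in lborel. u1 x = wd u x"
    using 1(2) by eventually_elim simp
  then have "weak_deriv (wd u) u2"
    using weak_deriv_cong_AE[OF u(5)] m by blast
  then have 2: "weak_deriv (wd u) (wd (wd u))" "AE x in lborel. wd (wd u) x = u2 x"
    using wd_AE_eq by auto
  show "sq_int u" "weak_deriv u (wd u)" "weak_deriv (wd u) (wd (wd u))"
    using u 1 2 by auto
  show "sq_int (wd u)"
    using sq_int_cong_AE[OF u(2) 1(2) m] .
  show "sq_int (wd (wd u))"
    using sq_int_cong_AE[OF u(3) 2(2)] weak_deriv_borel[OF 2(1)] by simp
qed

text \<open>The choice operator is not linear on the nose; uniqueness restores linearity almost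
  everywhere, one derivative at a time.\<close>

lemma H2_lincomb:
  assumes "H2 u" "H2 v"
  shows "H2 (\<lambda>x. \<alpha> * u x + \<beta> * v x)"
    and "AE x in lborel. wd (\<lambda>x. \<alpha> * u x + \<beta> * v x) x = \<alpha> * wd u x + \<beta> * wd v x"
    and "AE x in lborel. wd (wd (\<lambda>x. \<alpha> * u x + \<beta> * v x)) x = \<alpha> * wd (wd u) x + \<beta> * wd (wd v) x"
proof -
  let ?w = "\<lambda>x. \<alpha> * u x + \<beta> * v x"
  note u = H2D[OF assms(1)] and v = H2D[OF assms(2)]
  have w1: "weak_deriv ?w (\<lambda>x. \<alpha> * wd u x + \<beta> * wd v x)"
    using u v weak_deriv_lincomb by blast
  have w2: "weak_deriv (\<lambda>x. \<alpha> * wd u x + \<beta> * wd v x) (\<lambda>x. \<alpha> * wd (wd u) x + \<beta> * wd (wd v) x)"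
    using u v weak_deriv_lincomb by blast
  show "H2 ?w"
    unfolding H2_def using w1 w2 u v sq_int_lincomb by blast
  show 1: "AE x in lborel. wd ?w x = \<alpha> * wd u x + \<beta> * wd v x"
    using wd_AE_eq[OF w1] by blast
  have m: "wd ?w \<in> borel_measurable lborel"
    using weak_deriv_borel(2)[OF wd_AE_eq(1)[OF w1]] by simp
  have "AE x in lborel. \<alpha> * wd u x + \<beta> * wd v x = wd ?w x"
    using 1 by eventually_elim simp
  then have "weak_deriv (wd ?w) (\<lambda>x. \<alpha> * wd (wd u) x + \<beta> * wd (wd v) x)"
    using weak_deriv_cong_AE[OF w2] m by blast
  then show "AE x in lborel. wd (wd ?w) x = \<alpha> * wd (wd u) x + \<beta> * wd (wd v) x"
    using wd_AE_eq by blast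
qed

section \<open>Essential boundedness of H^1 functions on the line\<close>

text \<open>Young's inequality \<open>\<bar>y\<bar> \<le> 1/2 + y\<^sup>2/2\<close> replaces
  Cauchy-Schwarz; the constant 1 is half the window length. The result is inhomogeneous but
  independent of \<open>n\<close>, and later only a bound uniform on norm-bounded sets is
  wanted.\<close>

lemma integral_abs_unit_le:
  assumes "sq_int f"
  shows "set_integrable lborel {n..n+2} f"
    and "(LINT x|lborel. indicator {n..n+2} x * \<bar>f x\<bar>) \<le> 1 + (LINT x|lborel. (f x)\<^sup>2)"
proof -
  show *: "set_integrable lborel {n..n+2} f"
    using sq_int_loc_integrable[OF assms] unfolding loc_integrable_def by blast
  have i: "integrable lborel (\<lambda>x. (f x)\<^sup>2)"
    using assms by (simp add: sq_int_def)
  have ind: "integrable lborel (indicator {n..n+2} :: real \<Rightarrow> real)"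
    by (rule integrable_real_indicator) (auto simp: emeasure_lborel_Icc_eq)
  have "(LINT x|lborel. indicator {n..n+2} x * \<bar>f x\<bar>)
      \<le> (LINT x|lborel. (1/2) * indicator {n..n+2} x + (1/2) * (f x)\<^sup>2)"
  proof (rule integral_mono)
    show "integrable lborel (\<lambda>x. indicator {n..n+2} x * \<bar>f x\<bar>)"
      using integrable_abs[OF *[unfolded set_integrable_def]] by (simp add: abs_mult)
    show "integrable lborel (\<lambda>x. (1/2) * indicator {n..n+2} x + (1/2) * (f x)\<^sup>2)"
      using i ind by auto
    have "\<bar>y\<bar> \<le> 1/2 + 1/2 * y\<^sup>2" for y :: real
      using zero_le_power2[of "\<bar>y\<bar> - 1"] by (simp add: power2_eq_square algebra_simps)
    from this[of "f x" for x]
    show "indicator {n..n+2} x * \<bar>f x\<bar> \<le> (1/2) * indicator {n..n+2} x + (1/2) * (f x)\<^sup>2" for x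
      by (auto simp: indicator_def)
  qed
  also have "\<dots> = 1 + (1/2) * (LINT x|lborel. (f x)\<^sup>2)"
    using i ind by (subst Bochner_Integration.integral_add) auto
  also have "\<dots> \<le> 1 + (LINT x|lborel. (f x)\<^sup>2)"
    by simp
  finally show "(LINT x|lborel. indicator {n..n+2} x * \<bar>f x\<bar>) \<le> 1 + (LINT x|lborel. (f x)\<^sup>2)" .
qed

text \<open>The antiderivative climbs from 0 to the total mass across the window, so subtracting two
  of them with equal mass leaves a compactly supported function.\<close>

lemma antiderivative_unit:
  fixes g :: "real \<Rightarrow> real"
  assumes g: "continuous_on UNIV g" "\<And>x. 0 \<le> g x" "\<And>x. x \<notin> {n<..<n+2} \<Longrightarrow> g x = 0"
  obtains \<Gamma> where "\<And>x. (\<Gamma> has_real_derivative g x) (at x)" "\<And>x. x \<le> n \<Longrightarrow> \<Gamma> x = 0"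
    "\<And>x. x \<ge> n+2 \<Longrightarrow> \<Gamma> x = (LINT x|lborel. g x)" "\<And>x. 0 \<le> \<Gamma> x" "\<And>x. \<Gamma> x \<le> (LINT x|lborel. g x)"
proof -
  obtain \<Phi> where \<Phi>: "\<And>x. (\<Phi> has_real_derivative g x) (at x)"
    using continuous_antiderivative[OF g(1)] by blast
  have mono: "\<Phi> x \<le> \<Phi> y" if "x \<le> y" for x y
    using that by (rule DERIV_nonneg_imp_nondecreasing) (use \<Phi> g(2) in blast)
  have const: "\<Phi> x = \<Phi> y" if "x < y" "\<And>z. x < z \<Longrightarrow> z < y \<Longrightarrow> g z = 0" for x y
    using MVT2[OF that(1), of \<Phi> g] \<Phi> that(2) by auto
  have left: "\<Phi> x = \<Phi> n" if "x \<le> n" for x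
    using const[of x n] that g(3) by (cases "x = n") auto
  have right: "\<Phi> x = \<Phi> (n+2)" if "x \<ge> n+2" for x
    using const[of "n+2" x] that g(3) by (cases "x = n+2") auto
  have "(LINT x|lborel. indicator {n..n+2} x *\<^sub>R g x) = \<Phi> (n+2) - \<Phi> n"
  proof (rule integral_FTC_atLeastAtMost)
    show "(\<Phi> has_vector_derivative g x) (at x within {n..n+2})" for x
      using \<Phi>[of x] by (simp add: has_real_derivative_iff_has_vector_derivative
          has_vector_derivative_at_within)
    show "continuous_on {n..n+2} g"
      using g(1) continuous_on_subset by blast
  qed auto
  moreover have "(\<lambda>x. indicator {n..n+2} x *\<^sub>R g x) = g"
  proof
    fix x
    show "indicator {n..n+2} x *\<^sub>R g x = g x"
      using g(3)[of x] by (cases "x \<in> {n<..<n+2}") auto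
  qed
  ultimately have I: "(LINT x|lborel. g x) = \<Phi> (n+2) - \<Phi> n"
    by simp
  show thesis
  proof (rule that[of "\<lambda>x. \<Phi> x - \<Phi> n"])
    show "((\<lambda>x. \<Phi> x - \<Phi> n) has_real_derivative g x) (at x)" for x
      using DERIV_diff[OF \<Phi> DERIV_const] by simp
    show "0 \<le> \<Phi> x - \<Phi> n" for x
    proof (cases "x \<le> n")
      case True
      then show ?thesis
        by (simp only: left[OF True])
    next
      case False
      then show ?thesis
        using mono[of n x] by simp
    qed
    show "\<Phi> x - \<Phi> n \<le> (LINT x|lborel. g x)" for x
    proof (cases "x \<ge> n+2")
      case True
      from right[OF this] show ?thesis
        by (simp only: I)
    next
      case False
      then show ?thesis
        using mono[of x "n+2"] I by simp
    qed
    show "\<Phi> x - \<Phi> n = 0" if "x \<le> n" for x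
      using left[OF that] by linarith
    show "\<Phi> x - \<Phi> n = (LINT x|lborel. g x)" if "x \<ge> n+2" for x
      using right[OF that] I by linarith
  qed
qed

lemma tent_integral_pos: "(LINT x|lborel. max 0 (1 - \<bar>x - (1::real)\<bar>)) > 0"
proof -
  let ?g = "\<lambda>x::real. max 0 (1 - \<bar>x - 1\<bar>)"
  have c: "continuous_on UNIV ?g"
    by (intro continuous_intros)
  obtain \<Gamma> where \<Gamma>: "\<And>x. (\<Gamma> has_real_derivative ?g x) (at x)" "\<And>x. x \<le> 0 \<Longrightarrow> \<Gamma> x = 0"
    "\<And>x. x \<ge> 0+2 \<Longrightarrow> \<Gamma> x = (LINT x|lborel. ?g x)"
    by (rule antiderivative_unit[OF c, of 0]) auto
  obtain z where "0 < z" "z < 2" "\<Gamma> 2 - \<Gamma> 0 = (2 - 0) * ?g z"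
    using MVT2[of 0 2 \<Gamma> ?g, OF _ \<Gamma>(1)] by (auto simp del: max_def)
  then show ?thesis
    using \<Gamma>(2)[of 0] \<Gamma>(3)[of 2] by (auto simp: abs_if max_def split: if_splits)
qed


text \<open>Weak version of recovering \<open>u\<close> from an average of \<open>u\<close> plus an
  integral of \<open>u1\<close>. Integration by parts against \<phi> replaces the bump
  \<open>g\<close> by a multiple \<open>I / c\<close> of a fixed tent of mass \<open>c\<close>; the
  tent pairing contributes the factor \<open>1 / c\<close>, and the pairing of \<open>u1\<close>
  with \<phi>, whose size is at most the mass \<open>I\<close> of \<open>g\<close>, contributes the
  1. What matters is that the bound is linear in the mass of \<open>g\<close>.\<close>

lemma integral_mult_test_le:
  fixes u u1 :: "real \<Rightarrow> real" and n :: real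
  defines "c \<equiv> LINT x|lborel. max 0 (1 - \<bar>x - (1::real)\<bar>)"
  assumes w: "weak_deriv u u1" and u: "sq_int u" "sq_int u1"
    and g: "test_fun g" "\<And>x. 0 \<le> g x" "\<And>x. x \<notin> {n<..<n+2} \<Longrightarrow> g x = 0"
  shows "\<bar>LINT x|lborel. u x * g x\<bar>
    \<le> (1 + 1 / c) * (1 + (LINT x|lborel. (u x)\<^sup>2) + (LINT x|lborel. (u1 x)\<^sup>2) + 1)
       * (LINT x|lborel. g x)"
proof -
  define tent where "tent x = max 0 (1 - \<bar>x - (1::real)\<bar>)" for x
  have c: "c > 0" "c = (LINT x|lborel. tent x)"
    using tent_integral_pos by (auto simp: c_def tent_def)
  have tc: "continuous_on UNIV tent"
    unfolding tent_def by (intro continuous_intros)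
  have tent: "0 \<le> tent x" "tent x \<le> 1" "x \<notin> {0<..<0+2} \<Longrightarrow> tent x = 0" for x
    by (auto simp: tent_def)
  define A where "A = (LINT x|lborel. (u x)\<^sup>2)"
  define A1 where "A1 = (LINT x|lborel. (u1 x)\<^sup>2)"
  define I where "I = (LINT x|lborel. g x)"
  have pos: "0 \<le> A" "0 \<le> A1" "0 \<le> I"
    using g(2) by (auto simp: A_def A1_def I_def intro!: integral_nonneg_AE)
  obtain H where H: "\<And>x. (H has_real_derivative tent x) (at x)" "\<And>x. x \<le> 0 \<Longrightarrow> H x = 0"
    "\<And>x. x \<ge> 0+2 \<Longrightarrow> H x = c" "\<And>x. 0 \<le> H x" "\<And>x. H x \<le> c"
    unfolding c(2) using antiderivative_unit[of tent 0] tc tent by metis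
  have gc: "continuous_on UNIV g"
    using test_fun_continuous[OF g(1)] by simp
  obtain \<Gamma> where \<Gamma>: "\<And>x. (\<Gamma> has_real_derivative g x) (at x)" "\<And>x. x \<le> n \<Longrightarrow> \<Gamma> x = 0"
    "\<And>x. x \<ge> n+2 \<Longrightarrow> \<Gamma> x = I" "\<And>x. 0 \<le> \<Gamma> x" "\<And>x. \<Gamma> x \<le> I"
    unfolding I_def using antiderivative_unit[of g n] gc g by metis
  \<comment> \<open>Both terms rise by exactly \<open>I\<close> across the window, so \<phi>
    vanishes on either side of it and is a legitimate test function.\<close>
  define \<phi> where "\<phi> x = \<Gamma> x - I / c * H (x - n)" for x
  define \<eta> where "\<eta> x = tent (x - n)" for x
  have \<eta>c: "continuous_on UNIV \<eta>"
    unfolding \<eta>_def by (intro continuous_on_compose2[OF tc] continuous_intros) auto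
  have \<phi>D: "(\<phi> has_real_derivative g x - I / c * \<eta> x) (at x)" for x
  proof -
    have "((\<lambda>x. H (x + - n)) has_real_derivative tent (x + - n)) (at x)"
      using H(1)[of "x + - n"] DERIV_shift by blast
    then show ?thesis
      unfolding \<phi>_def \<eta>_def by (intro DERIV_diff DERIV_cmult \<Gamma>) simp
  qed
  have out: "\<phi> x = 0" if "x \<notin> {n..n+2}" for x
    using that H(2,3)[of "x - n"] \<Gamma>(2,3)[of x] c(1) by (cases "x \<le> n") (auto simp: \<phi>_def)
  have \<phi>t: "test_fun \<phi>"
    by (rule test_funI[OF \<phi>D _ out bounded_closed_interval]) (intro continuous_intros gc \<eta>c)
  have \<phi>b: "\<bar>\<phi> x\<bar> \<le> I" for x
  proof -
    have "0 \<le> I / c * H (x - n)" "I / c * H (x - n) \<le> I / c * c"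
      using H(4,5)[of "x - n"] pos c(1) by (intro mult_nonneg_nonneg mult_left_mono; simp)+
    then show ?thesis
      using \<Gamma>(4,5)[of x] c(1) unfolding \<phi>_def by auto
  qed
  have dphi: "deriv \<phi> = (\<lambda>x. g x - I / c * \<eta> x)"
    using \<phi>D DERIV_imp_deriv by blast
  have loc: "loc_integrable u" "loc_integrable u1"
    using u sq_int_loc_integrable by auto
  have \<eta>i: "integrable lborel (\<lambda>x. u x * \<eta> x)"
  proof (rule loc_integrable_mult[OF loc(1) \<eta>c, of "\<bar>n\<bar> + 2"])
    show "\<eta> x = 0" if "\<bar>x\<bar> \<ge> \<bar>n\<bar> + 2" for x
      unfolding \<eta>_def by (rule tent(3)) (use that in auto)
  qed
  note gi = loc_integrable_test(1)[OF loc(1) g(1)]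
  note \<phi>i = loc_integrable_test(1)[OF loc(2) \<phi>t]
  have "(LINT x|lborel. u x * deriv \<phi> x) = - (LINT x|lborel. u1 x * \<phi> x)"
    using w \<phi>t unfolding weak_deriv_def by blast
  moreover have "(LINT x|lborel. u x * deriv \<phi> x)
      = (LINT x|lborel. u x * g x) - I / c * (LINT x|lborel. u x * \<eta> x)"
    unfolding dphi using gi \<eta>i by (simp add: right_diff_distrib mult.left_commute)
  ultimately have eq: "(LINT x|lborel. u x * g x)
      = I / c * (LINT x|lborel. u x * \<eta> x) - (LINT x|lborel. u1 x * \<phi> x)"
    by simp
  have i1: "\<bar>LINT x|lborel. u x * \<eta> x\<bar> \<le> 1 + A"
  proof -
    have "\<bar>LINT x|lborel. u x * \<eta> x\<bar> \<le> (LINT x|lborel. \<bar>u x * \<eta> x\<bar>)"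
      by (rule integral_abs_bound)
    also have "\<dots> \<le> (LINT x|lborel. indicator {n..n+2} x * \<bar>u x\<bar>)"
    proof (rule integral_mono)
      show "integrable lborel (\<lambda>x. indicator {n..n+2} x * \<bar>u x\<bar>)"
        using integrable_abs[OF integral_abs_unit_le(1)[OF u(1), of n, unfolded set_integrable_def]]
        by (simp add: abs_mult)
      show "\<bar>u x * \<eta> x\<bar> \<le> indicator {n..n+2} x * \<bar>u x\<bar>" for x
        using tent[of "x - n"]
        by (cases "x \<in> {n..n+2}") (auto simp: \<eta>_def abs_mult mult_left_le)
    qed (use \<eta>i in auto)
    finally show ?thesis
      using integral_abs_unit_le(2)[OF u(1), of n] by (simp add: A_def)
  qed
  have i2: "\<bar>LINT x|lborel. u1 x * \<phi> x\<bar> \<le> I * (1 + A1)"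
  proof -
    have "\<bar>LINT x|lborel. u1 x * \<phi> x\<bar> \<le> (LINT x|lborel. \<bar>u1 x * \<phi> x\<bar>)"
      by (rule integral_abs_bound)
    also have "\<dots> \<le> (LINT x|lborel. I * (indicator {n..n+2} x * \<bar>u1 x\<bar>))"
    proof (rule integral_mono)
      show "integrable lborel (\<lambda>x. I * (indicator {n..n+2} x * \<bar>u1 x\<bar>))"
        using integrable_abs[OF integral_abs_unit_le(1)[OF u(2), of n, unfolded set_integrable_def]]
        by (simp add: abs_mult)
      show "\<bar>u1 x * \<phi> x\<bar> \<le> I * (indicator {n..n+2} x * \<bar>u1 x\<bar>)" for x
        using out[of x] \<phi>b[of x]
        by (cases "x \<in> {n..n+2}") (auto simp: abs_mult mult.commute[of I] mult_left_mono)
    qed (use \<phi>i in auto)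
    also have "\<dots> = I * (LINT x|lborel. indicator {n..n+2} x * \<bar>u1 x\<bar>)"
      by simp
    also have "\<dots> \<le> I * (1 + A1)"
      using integral_abs_unit_le(2)[OF u(2), of n] pos by (auto simp: A1_def intro!: mult_left_mono)
    finally show ?thesis .
  qed
  have "\<bar>LINT x|lborel. u x * g x\<bar> \<le> \<bar>I / c * (LINT x|lborel. u x * \<eta> x)\<bar> + \<bar>LINT x|lborel. u1 x * \<phi> x\<bar>"
    unfolding eq by linarith
  also have "\<dots> \<le> I / c * (1 + A) + I * (1 + A1)"
  proof (rule add_mono[OF _ i2])
    have "\<bar>I / c\<bar> * \<bar>LINT x|lborel. u x * \<eta> x\<bar> \<le> I / c * (1 + A)"
      using i1 pos c(1) by (intro mult_mono) auto
    then show "\<bar>I / c * (LINT x|lborel. u x * \<eta> x)\<bar> \<le> I / c * (1 + A)"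
      by (simp only: abs_mult)
  qed
  also have "\<dots> \<le> I / c * (1 + A + A1 + 1) + I * (1 + A + A1 + 1)"
    using pos c(1) by (intro add_mono[of _ _ "I * (1 + A1)"]; intro mult_left_mono) auto
  also have "\<dots> = (1 + 1 / c) * (1 + A + A1 + 1) * I"
    by (simp add: algebra_simps)
  finally show ?thesis
    by (simp add: A_def A1_def I_def)
qed

text \<open>Duality: a pairing of \<open>u\<close> with every nonnegative bump bounded by
  \<open>m\<close> times the mass of the bump says that \<open>m + u\<close> and
  \<open>m - u\<close> pair nonnegatively with bumps, so both are nonnegative almost everywhere on
  each window. Countably many windows cover the line.\<close>

lemma H1_essentially_bounded:
  obtains C where "C > 0"
    "\<And>u u1. weak_deriv u u1 \<Longrightarrow> sq_int u \<Longrightarrow> sq_int u1 \<Longrightarrow>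
      AE x in lborel. \<bar>u x\<bar> \<le> C * (2 + (LINT x|lborel. (u x)\<^sup>2) + (LINT x|lborel. (u1 x)\<^sup>2))"
proof -
  define c where "c = (LINT x|lborel. max 0 (1 - \<bar>x - (1::real)\<bar>))"
  have c: "c > 0"
    unfolding c_def by (rule tent_integral_pos)
  show thesis
  proof (rule that[of "1 + 1 / c"])
    fix u u1 :: "real \<Rightarrow> real" assume w: "weak_deriv u u1" and u: "sq_int u" "sq_int u1"
    define m where "m = (1 + 1 / c) * (2 + (LINT x|lborel. (u x)\<^sup>2) + (LINT x|lborel. (u1 x)\<^sup>2))"
    have loc: "loc_integrable u"
      using u sq_int_loc_integrable by auto
    have one: "loc_integrable (\<lambda>_. 1)"
      unfolding loc_integrable_def by (auto intro!: borel_integrable_atLeastAtMost')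
    have int: "\<bar>LINT x|lborel. u x * g x\<bar> \<le> m * (LINT x|lborel. g x)"
      if "test_fun g" "\<And>x. 0 \<le> g x" "\<And>x. x \<notin> {n<..<n+2} \<Longrightarrow> g x = 0" for g n
      using integral_mult_test_le[OF w u that] unfolding m_def c_def by (simp add: add_ac)
    have shift: "AE x in lborel. x \<in> {n<..<n+2} \<longrightarrow> 0 \<le> m * 1 + s * u x"
      if s: "s \<in> {-1, 1}" for n s :: real
    proof (rule AE_nonneg_if_test)
      show "loc_integrable (\<lambda>x. m * 1 + s * u x)"
        by (rule loc_integrable_lincomb[OF one loc])
      fix g assume g: "test_fun g" "\<And>x. 0 \<le> g x" "\<And>x. x \<notin> {n<..<n+2} \<Longrightarrow> g x = 0"
      have "(LINT x|lborel. (m * 1 + s * u x) * g x) = m * (LINT x|lborel. g x) + s * (LINT x|lborel. u x * g x)"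
        using loc_integrable_test(1)[OF one g(1)] loc_integrable_test(1)[OF loc g(1)]
        by (simp add: distrib_right mult.assoc)
      then show "0 \<le> (LINT x|lborel. (m * 1 + s * u x) * g x)"
        using int[of g n] g s by auto
    qed auto
    have "AE x in lborel. \<forall>n::int. x \<in> {of_int n<..<of_int n+2} \<longrightarrow> \<bar>u x\<bar> \<le> m"
    proof (subst AE_all_countable, intro allI)
      fix n :: int
      show "AE x in lborel. x \<in> {of_int n<..<of_int n+2} \<longrightarrow> \<bar>u x\<bar> \<le> m"
        using shift[of 1 "of_int n", simplified] shift[of "-1" "of_int n", simplified]
        by eventually_elim auto
    qed
    then show "AE x in lborel. \<bar>u x\<bar>
        \<le> (1 + 1 / c) * (2 + (LINT x|lborel. (u x)\<^sup>2) + (LINT x|lborel. (u1 x)\<^sup>2))"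
    proof eventually_elim
      case (elim x)
      \<comment> \<open>Windows of length 2 at integer left ends overlap, so integers are covered as
        well; the left end \<open>\<lceil>x\<rceil> - 1\<close> is strictly below
        \<open>x\<close>.\<close>
      have "x \<in> {of_int (\<lceil>x\<rceil> - 1)<..<of_int (\<lceil>x\<rceil> - 1) + 2}"
        by simp linarith
      with elim show ?case
        unfolding m_def by blast
    qed
  qed (use c in \<open>auto intro: add_pos_pos\<close>)
qed

section \<open>Minimisation on the Nehari manifold\<close>

text \<open>Abstract jets: the first component collects the arguments of F and must be essentially
  bounded, the second collects top-order derivatives, for which square integrability is all there
  is.\<close>

definition admissible :: "'m measure \<Rightarrow> ('m \<Rightarrow> 'a::euclidean_space \<times> 'b::euclidean_space) \<Rightarrow> bool" where
  "admissible M Z \<longleftrightarrow> Z \<in> borel_measurable M \<and> integrable M (\<lambda>x. (norm (Z x))\<^sup>2)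
     \<and> (\<exists>R. AE x in M. norm (fst (Z x)) \<le> R)"

lemma admissible_bound:
  assumes "admissible M Z"
  obtains R where "R \<ge> 0" "AE x in M. norm (fst (Z x)) \<le> R"
proof -
  obtain R where "AE x in M. norm (fst (Z x)) \<le> R"
    using assms unfolding admissible_def by blast
  then have "AE x in M. norm (fst (Z x)) \<le> \<bar>R\<bar>"
    by eventually_elim linarith
  then show thesis
    using that[of "\<bar>R\<bar>"] by simp
qed

lemma norm_lincomb_sq_le:
  fixes z y :: "'a::real_normed_vector"
  assumes "\<bar>\<alpha>\<bar> \<le> A" "\<bar>\<beta>\<bar> \<le> A"
  shows "(norm (\<alpha> *\<^sub>R z + \<beta> *\<^sub>R y))\<^sup>2 \<le> 2 * A\<^sup>2 * ((norm z)\<^sup>2 + (norm y)\<^sup>2)"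
proof -
  have "norm (\<alpha> *\<^sub>R z + \<beta> *\<^sub>R y) \<le> \<bar>\<alpha>\<bar> * norm z + \<bar>\<beta>\<bar> * norm y"
    using norm_triangle_ineq[of "\<alpha> *\<^sub>R z" "\<beta> *\<^sub>R y"] by simp
  also have "\<dots> \<le> A * norm z + A * norm y"
    using assms by (intro add_mono mult_right_mono) auto
  finally have "(norm (\<alpha> *\<^sub>R z + \<beta> *\<^sub>R y))\<^sup>2 \<le> (A * (norm z + norm y))\<^sup>2"
    by (intro power_mono) (auto simp: algebra_simps)
  also have "\<dots> = A\<^sup>2 * (norm z + norm y)\<^sup>2"
    by (simp add: power_mult_distrib)
  also have "\<dots> \<le> A\<^sup>2 * (2 * ((norm z)\<^sup>2 + (norm y)\<^sup>2))"
    using zero_le_power2[of "norm z - norm y"]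
    by (intro mult_left_mono) (auto simp: power2_eq_square algebra_simps)
  finally show ?thesis
    by (simp only: ac_simps)
qed

lemma admissible_lincomb:
  assumes Z: "admissible M Z" and Y: "admissible M Y"
  shows "admissible M (\<lambda>x. \<alpha> *\<^sub>R Z x + \<beta> *\<^sub>R Y x)"
proof -
  obtain R S where RS: "AE x in M. norm (fst (Z x)) \<le> R" "AE x in M. norm (fst (Y x)) \<le> S"
    using Z Y unfolding admissible_def by blast
  have "AE x in M. norm (fst (\<alpha> *\<^sub>R Z x + \<beta> *\<^sub>R Y x)) \<le> \<bar>\<alpha>\<bar> * R + \<bar>\<beta>\<bar> * S"
    using RS
  proof eventually_elim
    case (elim x)
    have "norm (fst (\<alpha> *\<^sub>R Z x + \<beta> *\<^sub>R Y x)) \<le> \<bar>\<alpha>\<bar> * norm (fst (Z x)) + \<bar>\<beta>\<bar> * norm (fst (Y x))"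
      using norm_triangle_ineq[of "\<alpha> *\<^sub>R fst (Z x)" "\<beta> *\<^sub>R fst (Y x)"] by simp
    also have "\<dots> \<le> \<bar>\<alpha>\<bar> * R + \<bar>\<beta>\<bar> * S"
      using elim by (intro add_mono mult_left_mono) auto
    finally show ?case .
  qed
  moreover have m: "(\<lambda>x. \<alpha> *\<^sub>R Z x + \<beta> *\<^sub>R Y x) \<in> borel_measurable M"
    using Z Y unfolding admissible_def by auto
  moreover have "integrable M (\<lambda>x. (norm (\<alpha> *\<^sub>R Z x + \<beta> *\<^sub>R Y x))\<^sup>2)"
  proof (rule Bochner_Integration.integrable_bound)
    let ?A = "max \<bar>\<alpha>\<bar> \<bar>\<beta>\<bar>"
    show "integrable M (\<lambda>x. 2 * ?A\<^sup>2 * ((norm (Z x))\<^sup>2 + (norm (Y x))\<^sup>2))"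
      using Z Y unfolding admissible_def by auto
    show "AE x in M. norm ((norm (\<alpha> *\<^sub>R Z x + \<beta> *\<^sub>R Y x))\<^sup>2)
        \<le> norm (2 * ?A\<^sup>2 * ((norm (Z x))\<^sup>2 + (norm (Y x))\<^sup>2))"
    proof (rule AE_I2)
      fix x
      show "norm ((norm (\<alpha> *\<^sub>R Z x + \<beta> *\<^sub>R Y x))\<^sup>2)
          \<le> norm (2 * ?A\<^sup>2 * ((norm (Z x))\<^sup>2 + (norm (Y x))\<^sup>2))"
        using norm_lincomb_sq_le[of \<alpha> ?A \<beta> "Z x" "Y x"] by simp
    qed
  qed (use m in measurable)
  ultimately show ?thesis
    unfolding admissible_def by blast
qed

lemma admissible_scaleR:
  assumes "admissible M Z"
  shows "admissible M (\<lambda>x. t *\<^sub>R Z x)"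
  using admissible_lincomb[OF assms assms, of t 0] by simp

lemma integrable_norm_mult:
  assumes "admissible M Z" "admissible M Y"
  shows "integrable M (\<lambda>x. norm (Z x) * norm (Y x))"
proof (rule Bochner_Integration.integrable_bound)
  show "integrable M (\<lambda>x. (norm (Z x))\<^sup>2 + (norm (Y x))\<^sup>2)"
    using assms unfolding admissible_def by auto
  show "(\<lambda>x. norm (Z x) * norm (Y x)) \<in> borel_measurable M"
    using assms unfolding admissible_def by auto
  have "s * t \<le> s\<^sup>2 + t\<^sup>2" for s t :: real
    using zero_le_power2[of "s - t"] zero_le_power2[of s] zero_le_power2[of t]
    unfolding power2_diff by linarith
  then show "AE x in M. norm (norm (Z x) * norm (Y x)) \<le> norm ((norm (Z x))\<^sup>2 + (norm (Y x))\<^sup>2)"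
    by (auto intro!: AE_I2)
qed

text \<open>The constant may depend on a bound for the first component but not on the second; this
  is exactly what makes the integral of \<open>f\<close> along an admissible map finite.\<close>

definition quadratically_bounded :: "('a::euclidean_space \<times> 'b::euclidean_space \<Rightarrow> real) \<Rightarrow> bool" where
  "quadratically_bounded f \<longleftrightarrow> continuous_on UNIV f \<and>
     (\<forall>R\<ge>0. \<exists>C\<ge>0. \<forall>z. norm (fst z) \<le> R \<longrightarrow> \<bar>f z\<bar> \<le> C * (norm z)\<^sup>2)"

text \<open>Dominated convergence: convergent coefficients are bounded, so all the combinations keep
  their first component in one ball and share one integrable majorant. It supplies the continuity in
  both parameters needed for the intermediate value argument.\<close>

lemma tendsto_integral_quadratically_bounded:
  assumes f: "quadratically_bounded f" and Z: "admissible M Z" and Y: "admissible M Y"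
    and lim: "\<alpha> \<longlonglongrightarrow> a" "\<beta> \<longlonglongrightarrow> b"
  shows "integrable M (\<lambda>x. f (a *\<^sub>R Z x + b *\<^sub>R Y x))"
    and "(\<lambda>n. LINT x|M. f (\<alpha> n *\<^sub>R Z x + \<beta> n *\<^sub>R Y x)) \<longlonglongrightarrow> (LINT x|M. f (a *\<^sub>R Z x + b *\<^sub>R Y x))"
proof -
  have fc: "continuous_on UNIV f"
    using f by (simp add: quadratically_bounded_def)
  have fm [measurable]: "f \<in> borel_measurable borel"
    using fc borel_measurable_continuous_onI by blast
  have [measurable]: "Z \<in> borel_measurable M" "Y \<in> borel_measurable M"
    using Z Y by (auto simp: admissible_def)
  obtain A1 A2 where "\<And>n. \<bar>\<alpha> n\<bar> \<le> A1" "\<And>n. \<bar>\<beta> n\<bar> \<le> A2"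
    using convergent_imp_Bseq[OF convergentI[OF lim(1)]] convergent_imp_Bseq[OF convergentI[OF lim(2)]]
    unfolding Bseq_def by (metis real_norm_def)
  then obtain A where A: "\<And>n. \<bar>\<alpha> n\<bar> \<le> A" "\<And>n. \<bar>\<beta> n\<bar> \<le> A" "A \<ge> 0"
    by (metis abs_ge_zero max.cobounded1 max.cobounded2 order_trans)
  obtain R S where RS: "AE x in M. norm (fst (Z x)) \<le> R" "AE x in M. norm (fst (Y x)) \<le> S" "R \<ge> 0" "S \<ge> 0"
    using admissible_bound[OF Z] admissible_bound[OF Y] by metis
  have "A * R + A * S \<ge> 0"
    using A RS by auto
  then obtain C where C: "C \<ge> 0" "\<And>z. norm (fst z) \<le> A * R + A * S \<Longrightarrow> \<bar>f z\<bar> \<le> C * (norm z)\<^sup>2"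
    using f unfolding quadratically_bounded_def by blast
  let ?w = "\<lambda>x. C * (2 * A\<^sup>2 * ((norm (Z x))\<^sup>2 + (norm (Y x))\<^sup>2))"
  have w: "integrable M ?w"
    using Z Y unfolding admissible_def by auto
  have bd: "AE x in M. norm (f (\<alpha> n *\<^sub>R Z x + \<beta> n *\<^sub>R Y x)) \<le> ?w x" for n
    using RS(1,2)
  proof eventually_elim
    case (elim x)
    have "norm (fst (\<alpha> n *\<^sub>R Z x + \<beta> n *\<^sub>R Y x)) \<le> \<bar>\<alpha> n\<bar> * norm (fst (Z x)) + \<bar>\<beta> n\<bar> * norm (fst (Y x))"
      using norm_triangle_ineq[of "\<alpha> n *\<^sub>R fst (Z x)" "\<beta> n *\<^sub>R fst (Y x)"] by simp
    also have "\<dots> \<le> A * R + A * S"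
      using elim A by (intro add_mono mult_mono) auto
    finally have "\<bar>f (\<alpha> n *\<^sub>R Z x + \<beta> n *\<^sub>R Y x)\<bar> \<le> C * (norm (\<alpha> n *\<^sub>R Z x + \<beta> n *\<^sub>R Y x))\<^sup>2"
      by (rule C(2))
    also have "\<dots> \<le> ?w x"
      using norm_lincomb_sq_le[OF A(1)[of n] A(2)[of n]] C(1) by (rule mult_left_mono)
    finally show ?case
      by simp
  qed
  have pt: "AE x in M. (\<lambda>n. f (\<alpha> n *\<^sub>R Z x + \<beta> n *\<^sub>R Y x)) \<longlonglongrightarrow> f (a *\<^sub>R Z x + b *\<^sub>R Y x)"
    using fc by (intro AE_I2 continuous_on_tendsto_compose[OF fc] tendsto_intros lim) auto
  show "integrable M (\<lambda>x. f (a *\<^sub>R Z x + b *\<^sub>R Y x))"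
    by (rule integrable_dominated_convergence[OF _ _ w pt bd]) measurable
  show "(\<lambda>n. LINT x|M. f (\<alpha> n *\<^sub>R Z x + \<beta> n *\<^sub>R Y x)) \<longlonglongrightarrow> (LINT x|M. f (a *\<^sub>R Z x + b *\<^sub>R Y x))"
    by (rule integral_dominated_convergence[OF _ _ w pt bd]) measurable
qed

lemma integrable_quadratically_bounded:
  assumes "quadratically_bounded f" "admissible M Z"
  shows "integrable M (\<lambda>x. f (Z x))"
  using tendsto_integral_quadratically_bounded(1)[OF assms(1,2,2) tendsto_const[of 1] tendsto_const[of 0]]
  by simp

lemma quadratically_bounded_diff:
  assumes "quadratically_bounded f" "quadratically_bounded g"
  shows "quadratically_bounded (\<lambda>z. f z - g z)"
  unfolding quadratically_bounded_def
proof (intro conjI allI impI)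
  show "continuous_on UNIV (\<lambda>z. f z - g z)"
    using assms unfolding quadratically_bounded_def by (auto intro: continuous_intros)
  fix R :: real assume "R \<ge> 0"
  then obtain C D where CD: "C \<ge> 0" "D \<ge> 0" "\<And>z. norm (fst z) \<le> R \<Longrightarrow> \<bar>f z\<bar> \<le> C * (norm z)\<^sup>2"
    "\<And>z. norm (fst z) \<le> R \<Longrightarrow> \<bar>g z\<bar> \<le> D * (norm z)\<^sup>2"
    using assms unfolding quadratically_bounded_def by metis
  have "\<bar>f z - g z\<bar> \<le> (C + D) * (norm z)\<^sup>2" if "norm (fst z) \<le> R" for z
    using CD(3,4)[OF that] by (simp add: distrib_right)
  with CD show "\<exists>C\<ge>0. \<forall>z. norm (fst z) \<le> R \<longrightarrow> \<bar>f z - g z\<bar> \<le> C * (norm z)\<^sup>2"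
    by (intro exI[of _ "C + D"]) auto
qed

text \<open>\<open>'a\<close> carries the arguments of F, \<open>'b\<close> the derivatives seen
  only by the form \<open>B\<close>. \<open>DF_Lipschitz\<close> is the trace of C^2 regularity, and
  \<open>scaling\<close> is condition (a) integrated along rays.\<close>

locale nehari =
  fixes B :: "'a::euclidean_space \<times> 'b::euclidean_space \<Rightarrow> 'a \<times> 'b \<Rightarrow> real"
    and F :: "'a \<Rightarrow> real" and DF :: "'a \<Rightarrow> 'a" and p :: real
  assumes bilinear: "bounded_bilinear B"
    and sym: "B y z = B z y"
    and nonneg: "0 \<le> B z z"
    and F0: "F 0 = 0" and DF0: "DF 0 = 0"
    and F_deriv: "(F has_derivative (\<lambda>h. DF w \<bullet> h)) (at w)"
    and DF_Lipschitz: "R \<ge> 0 \<Longrightarrow> \<exists>C\<ge>0. \<forall>x\<in>cball 0 R. \<forall>y\<in>cball 0 R. norm (DF x - DF y) \<le> C * norm (x - y)"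
    and p_pos: "p > 0"
    and scaling: "t \<ge> 1 \<Longrightarrow> t powr (p + 2) * (w \<bullet> DF w) \<le> (t *\<^sub>R w) \<bullet> DF (t *\<^sub>R w)"
begin

interpretation B: bounded_bilinear B
  by (rule bilinear)

definition G :: "'a \<Rightarrow> real" where "G w = w \<bullet> DF w"
text \<open>\<open>j\<close>, \<open>q\<close> and \<open>dj\<close> are the densities of J, of P
  and of the derivative of J; symmetry of \<open>B\<close> absorbs the factor 1/2 in
  \<open>dj\<close>.\<close>

definition j :: "'a \<times> 'b \<Rightarrow> real" where "j z = B z z / 2 - F (fst z)"
definition q :: "'a \<times> 'b \<Rightarrow> real" where "q z = B z z - G (fst z)"
definition dj :: "'a \<times> 'b \<Rightarrow> 'a \<times> 'b \<Rightarrow> real" where "dj z y = B z y - DF (fst z) \<bullet> fst y"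

lemma DF_continuous: "continuous_on UNIV DF"
proof (rule continuous_at_imp_continuous_on, intro ballI)
  fix w :: 'a
  obtain C where C: "C \<ge> 0"
    "\<And>x y. x \<in> cball 0 (norm w + 1) \<Longrightarrow> y \<in> cball 0 (norm w + 1) \<Longrightarrow> norm (DF x - DF y) \<le> C * norm (x - y)"
    using DF_Lipschitz[of "norm w + 1"] by auto
  have "continuous_on (ball 0 (norm w + 1)) DF"
  proof (rule lipschitz_on_continuous_on)
    show "C-lipschitz_on (ball 0 (norm w + 1)) DF"
      using C by (intro lipschitz_onI) (auto simp: dist_norm)
  qed
  then show "isCont DF w"
    by (auto simp: continuous_on_eq_continuous_at)
qed

lemma G_scale_le_one:
  assumes "0 < t" "t \<le> 1"
  shows "G (t *\<^sub>R w) \<le> t powr (p + 2) * G w"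
proof -
  have "(1/t) powr (p + 2) * G (t *\<^sub>R w) \<le> G w"
    using scaling[of "1/t" "t *\<^sub>R w"] assms unfolding G_def by simp
  then have "t powr (p + 2) * ((1/t) powr (p + 2) * G (t *\<^sub>R w)) \<le> t powr (p + 2) * G w"
    by (intro mult_left_mono) auto
  moreover have "t powr (p + 2) * (1/t) powr (p + 2) = 1"
    using assms by (simp add: powr_divide)
  ultimately show ?thesis
    by (simp flip: mult.assoc)
qed

lemma G_scale_ge_one:
  assumes "1 \<le> t"
  shows "t powr (p + 2) * G w \<le> G (t *\<^sub>R w)"
  using scaling[OF assms] by (simp add: G_def)

text \<open>Along the ray, F(sw) has derivative G(sw)/s, while the comparison term has derivative
  \<open>s powr (p + 1) * G w\<close>. By the scaling of G their difference has the sign of s - 1,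
  so \<open>f\<close> is smallest at 1. The value t = 0 is included on purpose: it gives
  \<open>F w \<le> G w / (p + 2)\<close> since F(0) = 0.\<close>

lemma F_scale:
  assumes t: "t \<ge> 0"
  shows "G w * (t powr (p + 2) - 1) / (p + 2) \<le> F (t *\<^sub>R w) - F w"
proof -
  define f where "f s = F (s *\<^sub>R w) - G w * (s powr (p + 2)) / (p + 2)" for s
  have Fs: "((\<lambda>s. F (s *\<^sub>R w)) has_real_derivative DF (s *\<^sub>R w) \<bullet> w) (at s)" for s
    unfolding has_field_derivative_def
    by (rule has_derivative_eq_rhs[OF has_derivative_compose[OF _ F_deriv]])
      (auto intro!: derivative_eq_intros simp: fun_eq_iff)
  have f: "(f has_real_derivative DF (s *\<^sub>R w) \<bullet> w - G w * s powr (p + 1)) (at s)" if "s > 0" for s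
  proof -
    have "((\<lambda>s. G w * (s powr (p + 2)) / (p + 2)) has_real_derivative G w * s powr (p + 1)) (at s)"
      using that p_pos by (auto intro!: derivative_eq_intros simp: add.commute)
    with Fs show ?thesis
      unfolding f_def by (rule DERIV_diff)
  qed
  \<comment> \<open>The derivative is available only for s > 0; continuity up to 0 lets the mean
    value theorem reach t = 0.\<close>
  have fc: "continuous_on {0..} f"
    unfolding f_def
  proof (intro continuous_on_diff continuous_on_divide continuous_on_mult continuous_on_const)
    show "continuous_on {0..} (\<lambda>s. F (s *\<^sub>R w))"
      using Fs by (meson DERIV_isCont continuous_at_imp_continuous_on)
    show "continuous_on {0..} (\<lambda>s. s powr (p + 2))"
      using p_pos by (intro continuous_on_powr' continuous_intros) auto
  qed (use p_pos in auto)
  have df: "DF (s *\<^sub>R w) \<bullet> w - G w * s powr (p + 1) = (G (s *\<^sub>R w) - s powr (p + 2) * G w) / s" if "s > 0" for s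
  proof -
    have "s powr (p + 2) = s powr (p + 1) * s"
      using powr_add[of s "p + 1" 1] that by (simp add: add.assoc)
    then show ?thesis
      using that by (simp add: G_def field_simps inner_commute)
  qed
  define d where "d s = (G (s *\<^sub>R w) - s powr (p + 2) * G w) / s" for s
  have fd: "(f has_derivative (*) (d s)) (at s)" if "s > 0" for s
    using f[OF that] df[OF that] by (simp add: d_def has_field_derivative_def)
  consider "t = 1" | "t < 1" | "1 < t"
    by linarith
  then have "f 1 \<le> f t"
  proof cases
    case 2
    obtain s where s: "t < s" "s < 1" "f 1 - f t = d s * (1 - t)"
    proof (rule mvt[OF 2, where f=f and f'="\<lambda>s. (*) (d s)"])
      show "continuous_on {t..1} f"
        using t by (intro continuous_on_subset[OF fc]) auto
    qed (use fd t in auto)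
    have "d s \<le> 0"
      unfolding d_def using G_scale_le_one[of s w] s t by (intro divide_nonpos_nonneg) auto
    then show ?thesis
      using s 2 mult_nonpos_nonneg[of "d s" "1 - t"] by linarith
  next
    case 3
    obtain s where s: "1 < s" "s < t" "f t - f 1 = d s * (t - 1)"
    proof (rule mvt[OF 3, where f=f and f'="\<lambda>s. (*) (d s)"])
      show "continuous_on {1..t} f"
        by (intro continuous_on_subset[OF fc]) auto
    qed (use fd in auto)
    have "0 \<le> d s"
      unfolding d_def using G_scale_ge_one[of s w] s by (intro divide_nonneg_nonneg) auto
    then show ?thesis
      using s 3 mult_nonneg_nonneg[of "d s" "t - 1"] by linarith
  qed simp
  then show ?thesis
    by (simp add: f_def right_diff_distrib diff_divide_distrib)
qed

text \<open>The gradient is taken at \<open>w0\<close> while the step starts at \<open>w\<close>;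
  the mismatch costs \<open>norm (w - w0)\<close>. The descent argument needs this, since it steps
  from a rescaled point but knows the derivative only at the original one.\<close>

lemma F_linearisation:
  assumes "R \<ge> 0"
  shows "\<exists>C\<ge>0. \<forall>w0 w h. norm w0 \<le> R \<longrightarrow> norm w \<le> R \<longrightarrow> norm h \<le> R \<longrightarrow>
    \<bar>F (w + h) - F w - DF w0 \<bullet> h\<bar> \<le> C * norm h * (norm (w - w0) + norm h)"
proof -
  \<comment> \<open>Radius \<open>2 * R\<close> because the mean value inequality visits the whole
    segment from \<open>w\<close> to \<open>w + h\<close>.\<close>
  obtain C where C: "C \<ge> 0"
    "\<And>x y. x \<in> cball 0 (2 * R) \<Longrightarrow> y \<in> cball 0 (2 * R) \<Longrightarrow> norm (DF x - DF y) \<le> C * norm (x - y)"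
    using DF_Lipschitz[of "2 * R"] assms by auto
  have "\<bar>F (w + h) - F w - DF w0 \<bullet> h\<bar> \<le> C * norm h * (norm (w - w0) + norm h)"
    if b: "norm w0 \<le> R" "norm w \<le> R" "norm h \<le> R" for w0 w h
  proof -
    let ?f = "\<lambda>x. F x - DF w0 \<bullet> x"
    have "norm (?f (w + h) - ?f w) \<le> C * (norm (w - w0) + norm h) * norm (w + h - w)"
    proof (rule differentiable_bound)
      show "convex (closed_segment w (w + h))"
        by (rule convex_closed_segment)
      fix x assume "x \<in> closed_segment w (w + h)"
      then have x: "norm (x - w) \<le> norm h"
        using segment_bound1[of x w "w + h"] by simp
      show "(?f has_derivative (\<lambda>k. (DF x - DF w0) \<bullet> k)) (at x within closed_segment w (w + h))"
        by (rule has_derivative_at_withinI)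
          (auto intro!: derivative_eq_intros F_deriv simp: inner_diff_left)
      have "norm x \<le> norm (x - w) + norm w"
        using norm_triangle_ineq[of "x - w" w] by simp
      with x b have "x \<in> cball 0 (2 * R)"
        by simp
      moreover have "w0 \<in> cball 0 (2 * R)"
        using b assms by simp
      ultimately have "norm (DF x - DF w0) \<le> C * norm (x - w0)"
        by (rule C(2))
      also have "norm (x - w0) \<le> norm (w - w0) + norm h"
        using norm_triangle_ineq[of "x - w" "w - w0"] x by simp
      finally have "norm (DF x - DF w0) \<le> C * (norm (w - w0) + norm h)"
        using C(1) by (simp add: mult_left_mono)
      then show "onorm (\<lambda>k. (DF x - DF w0) \<bullet> k) \<le> C * (norm (w - w0) + norm h)"
        by (intro onorm_le order_trans[OF Cauchy_Schwarz_ineq2[THEN order_trans[OF eq_refl[OF real_norm_def]]]] mult_right_mono) auto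
    qed auto
    then show ?thesis
      by (simp add: inner_right_distrib algebra_simps)
  qed
  with C(1) show ?thesis
    by blast
qed

section \<open>Quadratic bounds, integrability and linearisation of the densities\<close>

lemma quadratically_bounded_B: "quadratically_bounded (\<lambda>z. B z z)"
  unfolding quadratically_bounded_def
proof (intro conjI allI impI)
  show "continuous_on UNIV (\<lambda>z. B z z)"
    by (intro B.continuous_on continuous_intros)
  obtain K where K: "K \<ge> 0" "\<And>z y. norm (B z y) \<le> norm z * norm y * K"
    using B.nonneg_bounded by blast
  have "\<bar>B z z\<bar> \<le> K * (norm z)\<^sup>2" for z
    using K(2)[of z z] by (simp add: power2_eq_square mult_ac)
  then show "\<exists>C\<ge>0. \<forall>z. norm (fst z) \<le> R \<longrightarrow> \<bar>B z z\<bar> \<le> C * (norm z)\<^sup>2" for R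
    using K(1) by blast
qed

lemma quadratically_bounded_fst:
  assumes "continuous_on UNIV g" "\<And>R. R \<ge> 0 \<Longrightarrow> \<exists>C\<ge>0. \<forall>w. norm w \<le> R \<longrightarrow> \<bar>g w\<bar> \<le> C * (norm w)\<^sup>2"
  shows "quadratically_bounded (\<lambda>z :: 'a \<times> 'b. g (fst z))"
  unfolding quadratically_bounded_def
proof (intro conjI allI impI)
  show "continuous_on UNIV (\<lambda>z :: 'a \<times> 'b. g (fst z))"
    by (intro continuous_on_compose2[OF assms(1)] continuous_intros) auto
  fix R :: real assume "R \<ge> 0"
  then obtain C where C: "C \<ge> 0" "\<And>w. norm w \<le> R \<Longrightarrow> \<bar>g w\<bar> \<le> C * (norm w)\<^sup>2"
    using assms(2) by blast
  have "\<bar>g (fst z)\<bar> \<le> C * (norm z)\<^sup>2" if "norm (fst z) \<le> R" for z :: "'a \<times> 'b"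
  proof -
    have "(norm (fst z))\<^sup>2 \<le> (norm z)\<^sup>2"
      by (intro power_mono norm_fst_le[of "fst z" "snd z", simplified]) auto
    then have "C * (norm (fst z))\<^sup>2 \<le> C * (norm z)\<^sup>2"
      using C(1) by (rule mult_left_mono)
    then show ?thesis
      using C(2)[OF that] by linarith
  qed
  then show "\<exists>C\<ge>0. \<forall>z :: 'a \<times> 'b. norm (fst z) \<le> R \<longrightarrow> \<bar>g (fst z)\<bar> \<le> C * (norm z)\<^sup>2"
    using C(1) by blast
qed

lemma quadratically_bounded_F: "quadratically_bounded (\<lambda>z :: 'a \<times> 'b. F (fst z))"
proof (rule quadratically_bounded_fst)
  show "continuous_on UNIV F"
    using F_deriv has_derivative_continuous continuous_at_imp_continuous_on by blast
  fix R :: real assume "R \<ge> 0"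
  then obtain C where C: "C \<ge> 0" "\<And>w0 w h. norm w0 \<le> R \<Longrightarrow> norm w \<le> R \<Longrightarrow> norm h \<le> R \<Longrightarrow>
    \<bar>F (w + h) - F w - DF w0 \<bullet> h\<bar> \<le> C * norm h * (norm (w - w0) + norm h)"
    using F_linearisation by blast
  have "\<bar>F w\<bar> \<le> C * (norm w)\<^sup>2" if "norm w \<le> R" for w
    using C(2)[of 0 0 w] that \<open>R \<ge> 0\<close> by (simp add: F0 DF0 power2_eq_square mult.assoc)
  then show "\<exists>C\<ge>0. \<forall>w. norm w \<le> R \<longrightarrow> \<bar>F w\<bar> \<le> C * (norm w)\<^sup>2"
    using C(1) by blast
qed

lemma DF_linear_bound:
  assumes "R \<ge> 0"
  shows "\<exists>C\<ge>0. \<forall>w. norm w \<le> R \<longrightarrow> norm (DF w) \<le> C * norm w"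
proof -
  obtain C where C: "C \<ge> 0" "\<And>x y. x \<in> cball 0 R \<Longrightarrow> y \<in> cball 0 R \<Longrightarrow> norm (DF x - DF y) \<le> C * norm (x - y)"
    using DF_Lipschitz[OF assms] by auto
  then show ?thesis
    using C(2)[of _ 0] assms by (intro exI[of _ C]) (auto simp: DF0)
qed

lemma quadratically_bounded_G: "quadratically_bounded (\<lambda>z :: 'a \<times> 'b. G (fst z))"
proof (rule quadratically_bounded_fst)
  show "continuous_on UNIV G"
    unfolding G_def by (intro continuous_intros DF_continuous)
  fix R :: real assume "R \<ge> 0"
  then obtain C where C: "C \<ge> 0" "\<And>w. norm w \<le> R \<Longrightarrow> norm (DF w) \<le> C * norm w"
    using DF_linear_bound by blast
  have "\<bar>G w\<bar> \<le> C * (norm w)\<^sup>2" if "norm w \<le> R" for w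
  proof -
    have "\<bar>G w\<bar> \<le> norm w * norm (DF w)"
      unfolding G_def by (rule Cauchy_Schwarz_ineq2)
    also have "\<dots> \<le> norm w * (C * norm w)"
      using C(2)[OF that] by (intro mult_left_mono) auto
    finally show ?thesis
      by (simp add: power2_eq_square mult_ac)
  qed
  then show "\<exists>C\<ge>0. \<forall>w. norm w \<le> R \<longrightarrow> \<bar>G w\<bar> \<le> C * (norm w)\<^sup>2"
    using C(1) by blast
qed

lemma quadratically_bounded_q: "quadratically_bounded q"
  using quadratically_bounded_diff[OF quadratically_bounded_B quadratically_bounded_G]
  by (simp add: q_def[abs_def])

lemmas integrable_B = integrable_quadratically_bounded[OF quadratically_bounded_B]
  and integrable_F = integrable_quadratically_bounded[OF quadratically_bounded_F]
  and integrable_G = integrable_quadratically_bounded[OF quadratically_bounded_G]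

lemma integrable_j: "admissible M Z \<Longrightarrow> integrable M (\<lambda>x. j (Z x))"
  using integrable_B[of M Z] integrable_F[of M Z] by (simp add: j_def)

lemma integrable_dj:
  assumes Z: "admissible M Z" and Y: "admissible M Y"
  shows "integrable M (\<lambda>x. dj (Z x) (Y x))"
proof -
  have [measurable]: "Z \<in> borel_measurable M" "Y \<in> borel_measurable M"
    using Z Y by (auto simp: admissible_def)
  obtain R where R: "R \<ge> 0" "AE x in M. norm (fst (Z x)) \<le> R"
    using admissible_bound[OF Z] by blast
  obtain C where C: "C \<ge> 0" "\<And>w. norm w \<le> R \<Longrightarrow> norm (DF w) \<le> C * norm w"
    using DF_linear_bound[OF R(1)] by blast
  obtain K where K: "K \<ge> 0" "\<And>z y. norm (B z y) \<le> norm z * norm y * K"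
    using B.nonneg_bounded by blast
  have w: "integrable M (\<lambda>x. (K + C) * (norm (Z x) * norm (Y x)))"
    using integrable_norm_mult[OF Z Y] by simp
  have c: "continuous_on UNIV (\<lambda>zy. dj (fst zy) (snd zy))"
    unfolding dj_def by (intro continuous_intros B.continuous_on continuous_on_compose2[OF DF_continuous]) auto
  have "(\<lambda>x. (\<lambda>zy. dj (fst zy) (snd zy)) (Z x, Y x)) \<in> borel_measurable M"
    by (rule measurable_compose[OF _ borel_measurable_continuous_onI[OF c]]) simp
  then have m: "(\<lambda>x. dj (Z x) (Y x)) \<in> borel_measurable M"
    by simp
  have "AE x in M. norm (dj (Z x) (Y x)) \<le> norm ((K + C) * (norm (Z x) * norm (Y x)))"
    using R(2)
  proof eventually_elim
    case (elim x)
    have "\<bar>DF (fst (Z x)) \<bullet> fst (Y x)\<bar> \<le> norm (DF (fst (Z x))) * norm (fst (Y x))"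
      by (rule Cauchy_Schwarz_ineq2)
    also have "\<dots> \<le> (C * norm (Z x)) * norm (Y x)"
    proof (rule mult_mono)
      have "C * norm (fst (Z x)) \<le> C * norm (Z x)"
        using C(1) norm_fst_le[of "fst (Z x)" "snd (Z x)"] by (intro mult_left_mono) auto
      then show "norm (DF (fst (Z x))) \<le> C * norm (Z x)"
        using C(2)[OF elim] by linarith
      show "norm (fst (Y x)) \<le> norm (Y x)"
        using norm_fst_le[of "fst (Y x)" "snd (Y x)"] by simp
    qed (use C in auto)
    finally have "norm (dj (Z x) (Y x)) \<le> (K + C) * (norm (Z x) * norm (Y x))"
      using K(2)[of "Z x" "Y x"] by (simp add: dj_def algebra_simps)
    then show ?case
      using C(1) K(1) by simp
  qed
  with w m show ?thesis
    by (rule Bochner_Integration.integrable_bound)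
qed

lemma j_linearisation:
  assumes "R \<ge> 0"
  shows "\<exists>C\<ge>0. \<forall>z0 z y. norm (fst z0) \<le> R \<longrightarrow> norm (fst z) \<le> R \<longrightarrow> norm (fst y) \<le> R \<longrightarrow>
    \<bar>j (z + y) - j z - dj z0 y\<bar> \<le> C * norm y * (norm (z - z0) + norm y)"
proof -
  obtain C where C: "C \<ge> 0" "\<And>w0 w h. norm w0 \<le> R \<Longrightarrow> norm w \<le> R \<Longrightarrow> norm h \<le> R \<Longrightarrow>
    \<bar>F (w + h) - F w - DF w0 \<bullet> h\<bar> \<le> C * norm h * (norm (w - w0) + norm h)"
    using F_linearisation[OF assms] by blast
  obtain K where K: "K \<ge> 0" "\<And>z y. norm (B z y) \<le> norm z * norm y * K"
    using B.nonneg_bounded by blast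
  have nf: "norm (fst z) \<le> norm z" for z :: "'a \<times> 'b"
    using norm_fst_le[of "fst z" "snd z"] by simp
  have "\<bar>j (z + y) - j z - dj z0 y\<bar> \<le> (C + K) * norm y * (norm (z - z0) + norm y)"
    if b: "norm (fst z0) \<le> R" "norm (fst z) \<le> R" "norm (fst y) \<le> R" for z0 z y
  proof -
    have "\<bar>F (fst z + fst y) - F (fst z) - DF (fst z0) \<bullet> fst y\<bar>
        \<le> C * norm (fst y) * (norm (fst (z - z0)) + norm (fst y))"
      using C(2)[OF b] by simp
    also have "\<dots> \<le> C * norm y * (norm (z - z0) + norm y)"
      using nf[of y] nf[of "z - z0"] C(1) by (intro mult_mono add_mono mult_left_mono) auto
    finally have 1: "\<bar>F (fst z + fst y) - F (fst z) - DF (fst z0) \<bullet> fst y\<bar>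
        \<le> C * norm y * (norm (z - z0) + norm y)" .
    \<comment> \<open>For the quadratic part the remainder is an exact identity, so no restriction
      on the second component is required.\<close>
    have "B (z + y) (z + y) / 2 - B z z / 2 - B z0 y = B (z - z0) y + B y y / 2"
      using sym[of y z] by (simp add: B.add_left B.add_right B.diff_left field_simps)
    moreover have "\<bar>B (z - z0) y\<bar> \<le> norm (z - z0) * norm y * K" "\<bar>B y y / 2\<bar> \<le> norm y * norm y * K"
      using K(2)[of "z - z0" y] K(2)[of y y] by auto
    ultimately have "\<bar>B (z + y) (z + y) / 2 - B z z / 2 - B z0 y\<bar>
        \<le> norm (z - z0) * norm y * K + norm y * norm y * K"
      by linarith
    then have 2: "\<bar>B (z + y) (z + y) / 2 - B z z / 2 - B z0 y\<bar> \<le> K * norm y * (norm (z - z0) + norm y)"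
      by (simp only: distrib_left mult_ac)
    have "j (z + y) - j z - dj z0 y = (B (z + y) (z + y) / 2 - B z z / 2 - B z0 y)
        - (F (fst z + fst y) - F (fst z) - DF (fst z0) \<bullet> fst y)"
      by (simp add: j_def dj_def)
    then show ?thesis
      using 1 2 by (simp add: distrib_right)
  qed
  with C(1) K(1) show ?thesis
    by (intro exI[of _ "C + K"]) auto
qed

text \<open>Serves twice: with \<open>Z\<close> a multiple of \<open>Z0\<close> in the descent
  argument, and with \<open>Z = Z0\<close> for differentiability, where the mixed term disappears
  and only a quadratic remainder is left.\<close>

lemma integral_j_linearisation:
  assumes Z0: "admissible M Z0" "AE x in M. norm (fst (Z0 x)) \<le> R"
    and Z: "admissible M Z" "AE x in M. norm (fst (Z x)) \<le> R"
    and Y: "admissible M Y" "AE x in M. norm (fst (Y x)) \<le> R"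
    and C: "\<And>z0 z y. norm (fst z0) \<le> R \<Longrightarrow> norm (fst z) \<le> R \<Longrightarrow> norm (fst y) \<le> R \<Longrightarrow>
      \<bar>j (z + y) - j z - dj z0 y\<bar> \<le> C * norm y * (norm (z - z0) + norm y)"
  shows "\<bar>(LINT x|M. j (Z x + Y x)) - (LINT x|M. j (Z x)) - (LINT x|M. dj (Z0 x) (Y x))\<bar>
    \<le> C * (LINT x|M. norm (Y x) * norm (Z x - Z0 x)) + C * (LINT x|M. (norm (Y x))\<^sup>2)"
proof -
  have ZY: "admissible M (\<lambda>x. Z x + Y x)" "admissible M (\<lambda>x. Z x - Z0 x)"
    using admissible_lincomb[OF Z(1) Y(1), of 1 1] admissible_lincomb[OF Z(1) Z0(1), of 1 "-1"] by auto
  note i = integrable_j[OF ZY(1)] integrable_j[OF Z(1)] integrable_dj[OF Z0(1) Y(1)]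
  have y2: "integrable M (\<lambda>x. (norm (Y x))\<^sup>2)"
    using Y by (simp add: admissible_def)
  note yz = integrable_norm_mult[OF Y(1) ZY(2)]
  have "\<bar>(LINT x|M. j (Z x + Y x)) - (LINT x|M. j (Z x)) - (LINT x|M. dj (Z0 x) (Y x))\<bar>
      = \<bar>LINT x|M. j (Z x + Y x) - j (Z x) - dj (Z0 x) (Y x)\<bar>"
    using i by simp
  also have "\<dots> \<le> (LINT x|M. \<bar>j (Z x + Y x) - j (Z x) - dj (Z0 x) (Y x)\<bar>)"
    by (rule integral_abs_bound)
  also have "\<dots> \<le> (LINT x|M. C * (norm (Y x) * norm (Z x - Z0 x)) + C * (norm (Y x))\<^sup>2)"
  proof (rule integral_mono_AE)
    show "AE x in M. \<bar>j (Z x + Y x) - j (Z x) - dj (Z0 x) (Y x)\<bar>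
        \<le> C * (norm (Y x) * norm (Z x - Z0 x)) + C * (norm (Y x))\<^sup>2"
      using Z0(2) Z(2) Y(2)
    proof eventually_elim
      case (elim x)
      then show ?case
        using C[of "Z0 x" "Z x" "Y x"] by (simp add: algebra_simps power2_eq_square)
    qed
  qed (use i y2 yz in auto)
  also have "\<dots> = C * (LINT x|M. norm (Y x) * norm (Z x - Z0 x)) + C * (LINT x|M. (norm (Y x))\<^sup>2)"
    using y2 yz by simp
  finally show ?thesis .
qed

text \<open>On the manifold the integrals of \<open>B\<close> and \<open>G\<close> coincide, and F
  is at most G/(p+2) by \<open>F_scale\<close> at 0; hence J is at least 1/2 - 1/(p+2) times the
  integral of \<open>B\<close>. This bounds from below the set whose infimum defines
  \<open>Sw\<close>.\<close>

lemma integral_j_nonneg: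
  assumes Z: "admissible M Z" and q: "(LINT x|M. q (Z x)) = 0"
  shows "0 \<le> (LINT x|M. j (Z x))"
proof -
  note i = integrable_B[OF Z] integrable_F[OF Z] integrable_G[OF Z]
  have I: "(LINT x|M. B (Z x) (Z x)) = (LINT x|M. G (fst (Z x)))"
    using q i by (simp add: q_def)
  have I0: "0 \<le> (LINT x|M. B (Z x) (Z x))"
    by (intro integral_nonneg_AE AE_I2 nonneg)
  have "(LINT x|M. F (fst (Z x))) \<le> (LINT x|M. G (fst (Z x)) / (p + 2))"
  proof (rule integral_mono)
    show "F (fst (Z x)) \<le> G (fst (Z x)) / (p + 2)" for x
      using F_scale[of 0 "fst (Z x)"] by (simp add: F0)
  qed (use i in auto)
  also have "\<dots> = (LINT x|M. B (Z x) (Z x)) / (p + 2)"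
    using I by simp
  also have "\<dots> \<le> (LINT x|M. B (Z x) (Z x)) / 2"
    using I0 p_pos by (intro divide_left_mono) auto
  finally show ?thesis
    using i by (simp add: j_def)
qed

text \<open>The ray through a point of the Nehari manifold crosses it exactly once, and the functional is
  maximal on the ray at that crossing.\<close>

context
  fixes M :: "'m measure" and Z :: "'m \<Rightarrow> 'a \<times> 'b"
  assumes Z: "admissible M Z" and qZ: "(LINT x|M. q (Z x)) = 0"
    and pos: "0 < (LINT x|M. B (Z x) (Z x))"
begin

lemma integral_q_ray: "(LINT x|M. q (t *\<^sub>R Z x)) = t\<^sup>2 * (LINT x|M. B (Z x) (Z x)) - (LINT x|M. G (t *\<^sub>R fst (Z x)))"
  using integrable_B[OF Z] integrable_G[OF admissible_scaleR[OF Z]]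
  by (simp add: q_def B.scaleR_left B.scaleR_right power2_eq_square mult.assoc)

lemma integral_G_eq: "(LINT x|M. G (fst (Z x))) = (LINT x|M. B (Z x) (Z x))"
  using qZ integrable_B[OF Z] integrable_G[OF Z] by (simp add: q_def)

lemma integral_q_ray_neg:
  assumes "t > 1"
  shows "(LINT x|M. q (t *\<^sub>R Z x)) < 0"
proof -
  have "(LINT x|M. t powr (p + 2) * G (fst (Z x))) \<le> (LINT x|M. G (t *\<^sub>R fst (Z x)))"
    using integrable_G[OF Z] integrable_G[OF admissible_scaleR[OF Z], of t] G_scale_ge_one[of t] assms
    by (intro integral_mono) simp_all
  then have "t powr (p + 2) * (LINT x|M. B (Z x) (Z x)) \<le> (LINT x|M. G (t *\<^sub>R fst (Z x)))"
    by (simp add: integral_G_eq)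
  moreover have "t powr 2 < t powr (p + 2)"
    using assms p_pos by (intro powr_less_mono) auto
  then have "t\<^sup>2 * (LINT x|M. B (Z x) (Z x)) < t powr (p + 2) * (LINT x|M. B (Z x) (Z x))"
    using assms pos by (intro mult_strict_right_mono) auto
  ultimately show ?thesis
    unfolding integral_q_ray by linarith
qed

lemma integral_q_ray_pos:
  assumes "0 < t" "t < 1"
  shows "0 < (LINT x|M. q (t *\<^sub>R Z x))"
proof -
  have "(LINT x|M. G (t *\<^sub>R fst (Z x))) \<le> (LINT x|M. t powr (p + 2) * G (fst (Z x)))"
    using integrable_G[OF Z] integrable_G[OF admissible_scaleR[OF Z], of t] G_scale_le_one[of t] assms
    by (intro integral_mono) simp_all
  then have "(LINT x|M. G (t *\<^sub>R fst (Z x))) \<le> t powr (p + 2) * (LINT x|M. B (Z x) (Z x))"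
    by (simp add: integral_G_eq)
  moreover have "t powr (p + 2) < t powr 2"
    using assms p_pos by (intro powr_less_mono') auto
  then have "t powr (p + 2) * (LINT x|M. B (Z x) (Z x)) < t\<^sup>2 * (LINT x|M. B (Z x) (Z x))"
    using assms pos by (intro mult_strict_right_mono) auto
  ultimately show ?thesis
    unfolding integral_q_ray by linarith
qed

lemma integral_j_ray_le:
  assumes "0 < t"
  shows "(LINT x|M. j (t *\<^sub>R Z x)) \<le> (LINT x|M. j (Z x))"
proof -
  let ?I = "LINT x|M. B (Z x) (Z x)"
  note i = integrable_B[OF Z] integrable_F[OF Z] integrable_G[OF Z]
    integrable_F[OF admissible_scaleR[OF Z], of t]
  have "(LINT x|M. G (fst (Z x)) * ((t powr (p + 2) - 1) / (p + 2)))
      \<le> (LINT x|M. F (t *\<^sub>R fst (Z x)) - F (fst (Z x)))"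
    using i F_scale[of t] assms by (intro integral_mono) simp_all
  then have "?I * ((t powr (p + 2) - 1) / (p + 2)) \<le> (LINT x|M. F (t *\<^sub>R fst (Z x))) - (LINT x|M. F (fst (Z x)))"
    using i by (simp add: integral_G_eq)
  moreover have "?I * ((t\<^sup>2 - 1) / 2) \<le> ?I * ((t powr (p + 2) - 1) / (p + 2))"
  proof (rule mult_left_mono)
    \<comment> \<open>The scalar inequality follows from two tangent-line estimates, both sharp at t
      = 1: \<open>exp x \<ge> 1 + x\<close> at \<open>x = p * ln t\<close>, and
      \<open>ln y \<le> y - 1\<close> at the inverse of \<open>t\<^sup>2\<close>.\<close>
    have "t powr (p + 2) = t\<^sup>2 * exp (p * ln t)"
      using assms powr_add[of t p 2] by (simp add: powr_def[of t p])
    moreover have "t\<^sup>2 * (1 + p * ln t) \<le> t\<^sup>2 * exp (p * ln t)"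
      by (intro mult_left_mono exp_ge_add_one_self) auto
    moreover have "1 - inverse (t\<^sup>2) \<le> ln (t\<^sup>2)"
      using assms ln_le_minus_one[of "inverse (t\<^sup>2)"] by (simp add: ln_inverse)
    then have "t\<^sup>2 * (1 - inverse (t\<^sup>2)) \<le> t\<^sup>2 * (2 * ln t)"
      using assms by (intro mult_left_mono) (auto simp: ln_realpow)
    then have "t\<^sup>2 - 1 \<le> t\<^sup>2 * (2 * ln t)"
      using assms by (simp add: right_diff_distrib)
    then have "p / 2 * (t\<^sup>2 - 1) \<le> p / 2 * (t\<^sup>2 * (2 * ln t))"
      using p_pos by (intro mult_left_mono) auto
    then have "t\<^sup>2 + p / 2 * (t\<^sup>2 - 1) \<le> t\<^sup>2 * (1 + p * ln t)"
      by (simp add: algebra_simps)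
    ultimately have "t\<^sup>2 + p / 2 * (t\<^sup>2 - 1) \<le> t powr (p + 2)"
      by linarith
    then show "(t\<^sup>2 - 1) / 2 \<le> (t powr (p + 2) - 1) / (p + 2)"
      using p_pos by (simp add: field_simps)
  qed (use pos in simp)
  moreover have "(LINT x|M. j (t *\<^sub>R Z x)) - (LINT x|M. j (Z x))
      = ?I * ((t\<^sup>2 - 1) / 2) - ((LINT x|M. F (t *\<^sub>R fst (Z x))) - (LINT x|M. F (fst (Z x))))"
    using i by (simp add: j_def B.scaleR_left B.scaleR_right power2_eq_square field_simps)
  ultimately show ?thesis
    by linarith
qed

text \<open>A descent direction \<open>Y\<close> at \<open>Z\<close> is pushed back to the Nehari manifold by rescaling; the
  rescaling factor stays near 1 by the sign of \<open>q\<close> on the ray, and it costs nothing because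
  the functional is maximal on the ray through \<open>Z\<close> at \<open>Z\<close> itself.\<close>

lemma descent_on_manifold:
  assumes Y: "admissible M Y" and L: "(LINT x|M. dj (Z x) (Y x)) < 0"
  obtains t s r where "t > 0" "(LINT x|M. q (t *\<^sub>R Z x + (t * s) *\<^sub>R Y x)) = 0"
    "(LINT x|M. j (t *\<^sub>R Z x + (t * s) *\<^sub>R Y x)) < (LINT x|M. j (Z x))"
    "(LINT x|M. q (r *\<^sub>R Z x + (r * s) *\<^sub>R Y x)) \<noteq> 0"
proof -
  let ?L = "LINT x|M. dj (Z x) (Y x)"
  obtain R1 where R1: "R1 \<ge> 0" "AE x in M. norm (fst (Z x)) \<le> R1"
    by (rule admissible_bound[OF Z])
  obtain R2 where R2: "R2 \<ge> 0" "AE x in M. norm (fst (Y x)) \<le> R2"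
    by (rule admissible_bound[OF Y])
  note R12 = R1 R2
  \<comment> \<open>The factor 2 leaves room for multiples up to 2 of both \<open>Z\<close> and
    \<open>Y\<close>.\<close>
  define R where "R = 2 * (R1 + R2)"
  have R: "R \<ge> 0"
    using R12 by (simp add: R_def)
  have Rb: "AE x in M. norm (fst (t *\<^sub>R Z x)) \<le> R" "AE x in M. norm (fst (t *\<^sub>R Y x)) \<le> R"
    if "0 \<le> t" "t \<le> 2" for t
  proof -
    show "AE x in M. norm (fst (t *\<^sub>R Z x)) \<le> R"
      using R12(2)
    proof eventually_elim
      case (elim x)
      have "t * norm (fst (Z x)) \<le> 2 * R1"
        using elim that by (intro mult_mono) auto
      then show ?case
        using that R12 by (simp add: R_def)
    qed
    show "AE x in M. norm (fst (t *\<^sub>R Y x)) \<le> R"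
      using R12(4)
    proof eventually_elim
      case (elim x)
      have "t * norm (fst (Y x)) \<le> 2 * R2"
        using elim that by (intro mult_mono) auto
      then show ?case
        using that R12 by (simp add: R_def)
    qed
  qed
  obtain C where C: "C \<ge> 0" "\<And>z0 z y. norm (fst z0) \<le> R \<Longrightarrow> norm (fst z) \<le> R \<Longrightarrow> norm (fst y) \<le> R \<Longrightarrow>
      \<bar>j (z + y) - j z - dj z0 y\<bar> \<le> C * norm y * (norm (z - z0) + norm y)"
    using j_linearisation[OF R] by blast
  define D where "D = (LINT x|M. norm (Y x) * norm (Z x))"
  define E where "E = (LINT x|M. (norm (Y x))\<^sup>2)"
  have DE: "0 \<le> D" "0 \<le> E"
    by (auto simp: D_def E_def intro!: integral_nonneg_AE)
  \<comment> \<open>Step from \<open>t *\<^sub>R Z\<close> with the derivative taken at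
    \<open>Z\<close>: moving the base point costs \<open>\<bar>t - 1\<bar> * D\<close>, the second
    order of the step costs \<open>s * E\<close>. After factoring out \<open>t * s\<close>, the sign
    is that of \<open>?L\<close> once both costs are small.\<close>
  have est: "(LINT x|M. j (t *\<^sub>R Z x + (t * s) *\<^sub>R Y x)) - (LINT x|M. j (t *\<^sub>R Z x))
      \<le> (t * s) * (?L + C * (\<bar>t - 1\<bar> * D) + C * (2 * s * E))"
    if ts: "0 < t" "t \<le> 2" "0 < s" "s \<le> 1" for t s
  proof -
    have ts2: "0 \<le> t * s" "t * s \<le> 2"
      using ts mult_mono[of t 2 s 1] by auto
    have lin: "\<bar>(LINT x|M. j (t *\<^sub>R Z x + (t * s) *\<^sub>R Y x)) - (LINT x|M. j (t *\<^sub>R Z x)) - (LINT x|M. dj (Z x) ((t * s) *\<^sub>R Y x))\<bar>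
      \<le> C * (LINT x|M. norm ((t * s) *\<^sub>R Y x) * norm (t *\<^sub>R Z x - Z x)) + C * (LINT x|M. (norm ((t * s) *\<^sub>R Y x))\<^sup>2)"
      using Rb(1)[of 1] Rb(1)[of t] Rb(2)[OF ts2] ts C(2)
      by (intro integral_j_linearisation[where R=R] admissible_scaleR Z Y) auto
    have "(\<lambda>x. dj (Z x) ((t * s) *\<^sub>R Y x)) = (\<lambda>x. (t * s) * dj (Z x) (Y x))"
      by (auto simp: dj_def B.scaleR_right right_diff_distrib)
    then have e1: "(LINT x|M. dj (Z x) ((t * s) *\<^sub>R Y x)) = (t * s) * ?L"
      by simp
    have nn: "norm ((t * s) *\<^sub>R Y x) * norm (t *\<^sub>R Z x - Z x) = (t * s * \<bar>t - 1\<bar>) * (norm (Y x) * norm (Z x))" for x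
    proof -
      have "t *\<^sub>R Z x - Z x = (t - 1) *\<^sub>R Z x"
        by (simp add: scaleR_diff_left)
      then show ?thesis
        using ts by (simp add: abs_mult)
    qed
    have e2: "(LINT x|M. norm ((t * s) *\<^sub>R Y x) * norm (t *\<^sub>R Z x - Z x)) = (t * s * \<bar>t - 1\<bar>) * D"
      unfolding nn D_def by simp
    have e3: "(LINT x|M. (norm ((t * s) *\<^sub>R Y x))\<^sup>2) = (t * s)\<^sup>2 * E"
      using ts by (simp add: E_def power_mult_distrib)
    have "(LINT x|M. j (t *\<^sub>R Z x + (t * s) *\<^sub>R Y x)) - (LINT x|M. j (t *\<^sub>R Z x))
        \<le> (t * s) * ?L + C * ((t * s * \<bar>t - 1\<bar>) * D) + C * ((t * s)\<^sup>2 * E)"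
      using lin unfolding e1 e2 e3 by linarith
    also have "\<dots> = (t * s) * (?L + C * (\<bar>t - 1\<bar> * D) + C * (t * s * E))"
      by (simp add: algebra_simps power2_eq_square)
    also have "\<dots> \<le> (t * s) * (?L + C * (\<bar>t - 1\<bar> * D) + C * (2 * s * E))"
      using ts C(1) DE by (intro mult_left_mono add_left_mono mult_right_mono) auto
    finally show ?thesis .
  qed
  \<comment> \<open>Chosen so that moving the base point uses at most a quarter of
    \<open>- ?L\<close>; the \<open>+ 1\<close> guards against \<open>C * D = 0\<close>, and 1/2
    keeps \<open>1 - \<epsilon>\<close> positive and \<open>1 + \<epsilon>\<close> below 2.\<close>
  define \<epsilon> where "\<epsilon> = min (1/2) (- ?L / (4 * (C * D + 1)))"
  have CD: "0 \<le> C * D" "0 \<le> C * E"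
    using C(1) DE by auto
  have \<epsilon>: "0 < \<epsilon>" "\<epsilon> \<le> 1/2" "\<epsilon> * (C * D) \<le> - ?L / 4"
  proof -
    show pos: "0 < \<epsilon>"
      using L CD by (auto simp: \<epsilon>_def intro!: divide_neg_pos)
    show "\<epsilon> \<le> 1/2"
      unfolding \<epsilon>_def by (rule min.cobounded1)
    from pos have "\<epsilon> * (C * D) \<le> \<epsilon> * (C * D + 1)"
      by (intro mult_left_mono) auto
    also have "\<dots> \<le> (- ?L / (4 * (C * D + 1))) * (C * D + 1)"
      using CD by (intro mult_right_mono) (auto simp: \<epsilon>_def)
    also have "\<dots> = - ?L / 4"
      using CD by (simp add: divide_simps)
    finally show "\<epsilon> * (C * D) \<le> - ?L / 4" .
  qed
  define Q where "Q t s = (LINT x|M. q (t *\<^sub>R Z x + (t * s) *\<^sub>R Y x))" for t s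
  define \<sigma> where "\<sigma> n = inverse (real (Suc n))" for n
  have \<sigma>0: "\<sigma> \<longlonglongrightarrow> 0"
    unfolding \<sigma>_def by (rule LIMSEQ_inverse_real_of_nat)
  have Qlim: "(\<lambda>n. Q t (\<sigma> n)) \<longlonglongrightarrow> (LINT x|M. q (t *\<^sub>R Z x))" for t
  proof -
    have "(\<lambda>n. t * \<sigma> n) \<longlonglongrightarrow> t * 0"
      by (intro tendsto_intros \<sigma>0)
    from tendsto_integral_quadratically_bounded(2)[OF quadratically_bounded_q Z Y tendsto_const[of t] this]
    show ?thesis
      by (simp add: Q_def)
  qed
  \<comment> \<open>The strict signs of \<open>q\<close> on the unperturbed ray at the two ends
    persist for small \<open>s\<close>; with continuity in \<open>t\<close> they trap a zero of
    \<open>Q\<close> between the ends.\<close>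
  have "\<forall>\<^sub>F n in sequentially. 0 < Q (1 - \<epsilon>) (\<sigma> n)"
    by (rule order_tendstoD(1)[OF Qlim integral_q_ray_pos]) (use \<epsilon> in auto)
  moreover have "\<forall>\<^sub>F n in sequentially. Q (1 + \<epsilon>) (\<sigma> n) < 0"
    by (rule order_tendstoD(2)[OF Qlim integral_q_ray_neg]) (use \<epsilon> in auto)
  moreover have "\<forall>\<^sub>F n in sequentially. C * (2 * \<sigma> n * E) < - ?L / 4"
  proof -
    have "(\<lambda>n. C * (2 * \<sigma> n * E)) \<longlonglongrightarrow> C * (2 * 0 * E)"
      by (intro tendsto_intros \<sigma>0)
    then show ?thesis
      by (rule order_tendstoD(2)) (use L in auto)
  qed
  ultimately have "\<forall>\<^sub>F n in sequentially. 0 < Q (1 - \<epsilon>) (\<sigma> n) \<and> Q (1 + \<epsilon>) (\<sigma> n) < 0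
      \<and> C * (2 * \<sigma> n * E) < - ?L / 4"
    by eventually_elim blast
  then obtain n where n: "0 < Q (1 - \<epsilon>) (\<sigma> n)" "Q (1 + \<epsilon>) (\<sigma> n) < 0" "C * (2 * \<sigma> n * E) < - ?L / 4"
    using eventually_happens'[OF sequentially_bot] by blast
  define s where "s = \<sigma> n"
  have s: "0 < s" "s \<le> 1"
    by (auto simp: s_def \<sigma>_def divide_simps)
  have Qc: "continuous_on {1 - \<epsilon>..1 + \<epsilon>} (\<lambda>t. Q t s)"
    unfolding continuous_on_sequentially comp_def Q_def
    by (intro allI ballI impI tendsto_integral_quadratically_bounded(2)[OF quadratically_bounded_q Z Y])
      (auto intro!: tendsto_intros)
  obtain t where t: "1 - \<epsilon> \<le> t" "t \<le> 1 + \<epsilon>" "Q t s = 0"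
    using IVT2'[of "\<lambda>t. Q t s" "1 + \<epsilon>" 0 "1 - \<epsilon>"] n \<epsilon> Qc by (auto simp: s_def)
  have t0: "0 < t" "t \<le> 2"
    using t \<epsilon> by auto
  have "C * (\<bar>t - 1\<bar> * D) \<le> \<epsilon> * (C * D)"
  proof -
    have "\<bar>t - 1\<bar> * (C * D) \<le> \<epsilon> * (C * D)"
      using t CD by (intro mult_right_mono) auto
    then show ?thesis
      by (simp add: mult_ac)
  qed
  \<comment> \<open>Each cost is at most a quarter of \<open>- ?L\<close>, so the sum stays below
    half of \<open>?L\<close>.\<close>
  then have "?L + C * (\<bar>t - 1\<bar> * D) + C * (2 * s * E) < 0"
    using \<epsilon>(3) n(3) L by (simp add: s_def)
  then have "(t * s) * (?L + C * (\<bar>t - 1\<bar> * D) + C * (2 * s * E)) < 0"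
    using t0 s by (intro mult_pos_neg) auto
  then have "(LINT x|M. j (t *\<^sub>R Z x + (t * s) *\<^sub>R Y x)) < (LINT x|M. j (Z x))"
    using est[OF t0 s] integral_j_ray_le[OF t0(1)] by linarith
  \<comment> \<open>The witness \<open>1 - \<epsilon>\<close> for \<open>r\<close> certifies that
    \<open>Z + s Y\<close> is not zero: \<open>q\<close> has a nonzero integral at one of its
    multiples. The point returned is therefore not the trivial one.\<close>
  then show thesis
    using that[of t s "1 - \<epsilon>"] t t0 n(1) by (simp add: Q_def s_def)
qed

end

end

section \<open>The Boussinesq functional\<close>

lemma vec4_nth [simp]:
  "vec4 x1 x2 x3 x4 $ 1 = x1" "vec4 x1 x2 x3 x4 $ 2 = x2" "vec4 x1 x2 x3 x4 $ 3 = x3" "vec4 x1 x2 x3 x4 $ 4 = x4"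
  by (simp_all add: vec4_def vector_def)

lemma vec4_eq: "vec4 x1 x2 x3 x4 = x1 *\<^sub>R axis 1 1 + x2 *\<^sub>R axis 2 1 + x3 *\<^sub>R axis 3 1 + x4 *\<^sub>R axis 4 1"
  by (simp add: vec_eq_iff forall_4 axis_def)

lemma has_derivative_grad:
  fixes f :: "real^4 \<Rightarrow> real"
  assumes "f differentiable (at w)"
  shows "(f has_derivative (\<lambda>h. grad f w \<bullet> h)) (at w)"
proof -
  let ?D = "frechet_derivative f (at w)"
  have D: "(f has_derivative ?D) (at w)"
    using assms frechet_derivative_works by blast
  then have lin: "linear ?D"
    by (rule has_derivative_linear)
  have "?D h = grad f w \<bullet> h" for h
  proof -
    have "?D h = ?D (\<Sum>i\<in>UNIV. h $ i *\<^sub>R axis i 1)"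
      using basis_expansion[of h] by (simp add: scalar_mult_eq_scaleR)
    also have "\<dots> = (\<Sum>i\<in>UNIV. h $ i *\<^sub>R ?D (axis i 1))"
      using lin by (simp add: linear_sum linear_scale)
    also have "\<dots> = grad f w \<bullet> h"
      by (simp add: grad_def inner_vec_def mult.commute)
    finally show ?thesis .
  qed
  then have "?D = (\<lambda>h. grad f w \<bullet> h)"
    by blast
  with D show ?thesis
    by simp
qed

context
  fixes F :: "real^4 \<Rightarrow> real"
  assumes F: "C2_R4 F"
begin

lemma grad_has_derivative: "(grad F has_derivative (\<lambda>h. hess F w *v h)) (at w)"
  using F jacobian_works unfolding C2_R4_def hess_def by blast

lemma F_has_derivative: "(F has_derivative (\<lambda>h. grad F w \<bullet> h)) (at w)"
  using F has_derivative_grad unfolding C2_R4_def by blast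

lemma Gfun_has_derivative: "(Gfun F has_derivative (\<lambda>h. grad (Gfun F) w \<bullet> h)) (at w)"
proof (rule has_derivative_grad)
  have "(Gfun F has_derivative (\<lambda>h. w \<bullet> (hess F w *v h) + h \<bullet> grad F w)) (at w)"
    unfolding Gfun_def[abs_def] by (rule has_derivative_inner[OF has_derivative_ident grad_has_derivative])
  then show "Gfun F differentiable (at w)"
    unfolding differentiable_def by blast
qed

lemma grad_Lipschitz:
  "\<exists>C\<ge>0. \<forall>x\<in>cball 0 R. \<forall>y\<in>cball 0 R. norm (grad F x - grad F y) \<le> C * norm (x - y)"
proof -
  have "bilinear ((*v) :: real^4^4 \<Rightarrow> real^4 \<Rightarrow> real^4)"
    unfolding bilinear_def
    by (auto intro!: linearI simp: matrix_vector_mult_add_rdistrib matrix_vector_right_distrib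
        scaleR_matrix_vector_assoc matrix_vector_mult_scaleR)
  then obtain K where K: "K > 0" "\<And>(A::real^4^4) (x::real^4). norm (A *v x) \<le> norm A * norm x * K"
    using bilinear_conv_bounded_bilinear bounded_bilinear.pos_bounded by metis
  have "bounded (hess F ` cball 0 R)"
    using F unfolding C2_R4_def
    by (intro compact_imp_bounded compact_continuous_image) (auto intro: continuous_on_subset)
  then obtain H where H: "H > 0" "\<And>x. x \<in> cball 0 R \<Longrightarrow> norm (hess F x) \<le> H"
    unfolding bounded_pos by force
  have "norm (grad F x - grad F y) \<le> (H * K) * norm (x - y)" if "x \<in> cball 0 R" "y \<in> cball 0 R" for x y
  proof (rule differentiable_bound[OF convex_cball _ _ that])
    fix z :: "real^4" assume z: "z \<in> cball 0 R"
    show "(grad F has_derivative (\<lambda>h. hess F z *v h)) (at z within cball 0 R)"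
      using grad_has_derivative has_derivative_at_withinI by blast
    show "onorm ((*v) (hess F z)) \<le> H * K"
    proof (rule onorm_le)
      fix h :: "real^4"
      have "norm (hess F z *v h) \<le> norm (hess F z) * (norm h * K)"
        using K(2)[of "hess F z" h] by (simp add: mult.assoc)
      also have "\<dots> \<le> H * (norm h * K)"
        using H(2)[OF z] K(1) by (intro mult_right_mono) auto
      finally show "norm (hess F z *v h) \<le> H * K * norm h"
        by (simp add: mult_ac)
    qed
  qed
  with H K show ?thesis
    by (intro exI[of _ "H * K"]) auto
qed

text \<open>Condition (a) says precisely that
  \<open>s powr (- (p + 2)) * Gfun F (s *\<^sub>R w)\<close> has nonnegative derivative in
  \<open>s\<close>; comparing the values at 1 and \<open>t\<close> gives the claim.\<close>

lemma Gfun_scaling: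
  assumes a: "\<And>w. w \<bullet> grad (Gfun F) w \<ge> (p + 2) * Gfun F w" and t: "t \<ge> 1"
  shows "t powr (p + 2) * Gfun F w \<le> Gfun F (t *\<^sub>R w)"
proof -
  define g where "g s = Gfun F (s *\<^sub>R w) * s powr (- (p + 2))" for s
  have "g 1 \<le> g t"
  proof (rule DERIV_nonneg_imp_nondecreasing[OF t])
    fix s assume "1 \<le> s" "s \<le> t"
    then have s: "s > 0" by simp
    have 1: "((\<lambda>s. Gfun F (s *\<^sub>R w)) has_real_derivative grad (Gfun F) (s *\<^sub>R w) \<bullet> w) (at s)"
      unfolding has_field_derivative_def
      by (rule has_derivative_eq_rhs[OF has_derivative_compose[OF _ Gfun_has_derivative]])
        (auto intro!: derivative_eq_intros simp: fun_eq_iff)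
    have 2: "((\<lambda>s. s powr (- (p + 2))) has_real_derivative (- (p + 2)) * s powr (- (p + 2) - 1)) (at s)"
      using s by (auto intro!: derivative_eq_intros)
    let ?d = "grad (Gfun F) (s *\<^sub>R w) \<bullet> w * s powr (- (p + 2))
      + (- (p + 2)) * s powr (- (p + 2) - 1) * Gfun F (s *\<^sub>R w)"
    have "(g has_real_derivative ?d) (at s)"
      unfolding g_def[abs_def] by (rule DERIV_mult[OF 1 2])
    moreover have "?d = s powr (- (p + 2) - 1) * ((s *\<^sub>R w) \<bullet> grad (Gfun F) (s *\<^sub>R w) - (p + 2) * Gfun F (s *\<^sub>R w))"
    proof -
      have "s powr (- (p + 2)) = s powr (- (p + 2) - 1) * s"
        using powr_add[of s "- (p + 2) - 1" 1] s by (simp only: diff_add_cancel powr_one)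
      then show ?thesis
        by (simp only: inner_scaleR_left inner_commute) (simp add: algebra_simps)
    qed
    moreover have "0 \<le> s powr (- (p + 2) - 1) * ((s *\<^sub>R w) \<bullet> grad (Gfun F) (s *\<^sub>R w) - (p + 2) * Gfun F (s *\<^sub>R w))"
      using a[of "s *\<^sub>R w"] by (intro mult_nonneg_nonneg) (auto simp only: powr_ge_zero diff_ge_0_iff_ge)
    ultimately show "\<exists>y. (g has_real_derivative y) (at s) \<and> 0 \<le> y"
      by auto
  qed
  then have "Gfun F w \<le> Gfun F (t *\<^sub>R w) / t powr (p + 2)"
    unfolding g_def powr_minus by (simp add: divide_inverse)
  then show ?thesis
    using t by (simp add: field_simps)
qed

text \<open>Superquadratic growth of \<open>G\<close> along rays excludes a linear part of \<open>F\<close> at the origin.\<close>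

lemma grad_zero:
  assumes a: "\<And>w. w \<bullet> grad (Gfun F) w \<ge> (p + 2) * Gfun F w" and p: "p > 0"
  shows "grad F 0 = 0"
proof -
  let ?g = "grad F 0"
  define \<sigma> where "\<sigma> n = inverse (real (Suc n))" for n
  have \<sigma>: "\<sigma> \<longlonglongrightarrow> 0" "\<And>n. 0 < \<sigma> n" "\<And>n. \<sigma> n \<le> 1"
    unfolding \<sigma>_def using LIMSEQ_inverse_real_of_nat by (auto simp: divide_simps)
  \<comment> \<open>The ray is taken in the direction of the gradient at 0 itself. Scaling back from
    \<open>t *\<^sub>R ?g\<close> to \<open>?g\<close> and cancelling one \<open>t\<close> bounds a
    quantity tending to \<open>?g \<bullet> ?g\<close> by one tending to 0.\<close>
  have le: "?g \<bullet> grad F (t *\<^sub>R ?g) \<le> t powr (p + 1) * Gfun F ?g" if t: "0 < t" "t \<le> 1" for t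
  proof -
    have "(1 / t) powr (p + 2) * Gfun F (t *\<^sub>R ?g) \<le> Gfun F ?g"
      using Gfun_scaling[OF a, of "1 / t" "t *\<^sub>R ?g"] t by simp
    then have "Gfun F (t *\<^sub>R ?g) \<le> t powr (p + 2) * Gfun F ?g"
      using t by (simp add: powr_divide field_simps)
    moreover have "t powr (p + 2) = t * t powr (p + 1)"
      using powr_add[of t 1 "p + 1"] t by (simp add: add.commute)
    ultimately have "t * (?g \<bullet> grad F (t *\<^sub>R ?g)) \<le> t * (t powr (p + 1) * Gfun F ?g)"
      by (simp add: Gfun_def mult.assoc)
    then show ?thesis
      using t by simp
  qed
  have c: "isCont (grad F) 0"
    using grad_has_derivative has_derivative_continuous by blast
  have "(\<lambda>n. \<sigma> n *\<^sub>R ?g) \<longlonglongrightarrow> 0"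
    using tendsto_scaleR[OF \<sigma>(1) tendsto_const[of ?g]] by simp
  then have "(\<lambda>n. ?g \<bullet> grad F (\<sigma> n *\<^sub>R ?g)) \<longlonglongrightarrow> ?g \<bullet> ?g"
    using isCont_tendsto_compose[OF c] by (intro tendsto_intros) auto
  moreover have "(\<lambda>n. \<sigma> n powr (p + 1) * Gfun F ?g) \<longlonglongrightarrow> 0 powr (p + 1) * Gfun F ?g"
    using \<sigma> p by (intro tendsto_mult tendsto_const tendsto_powr') (auto simp: less_imp_le)
  ultimately have "?g \<bullet> ?g \<le> 0 powr (p + 1) * Gfun F ?g"
    by (rule LIMSEQ_le) (use le \<sigma> in auto)
  then show ?thesis
    using inner_ge_zero[of ?g] by (simp del: inner_ge_zero)
qed

end

section \<open>Jets of pairs in X\<close>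

text \<open>The first component lists the arguments of F in their order; the second derivatives are
  kept apart because they are not essentially bounded in general.\<close>

definition jet :: "(real \<Rightarrow> real) \<Rightarrow> (real \<Rightarrow> real) \<Rightarrow> real \<Rightarrow> (real^4) \<times> real \<times> real" where
  "jet \<psi> v x = (vec4 (\<psi> x) (wd \<psi> x) (v x) (wd v x), wd (wd \<psi>) x, wd (wd v) x)"

lemma norm_vec4_sq: "(norm (vec4 x1 x2 x3 x4))\<^sup>2 = x1\<^sup>2 + x2\<^sup>2 + x3\<^sup>2 + x4\<^sup>2"
  by (simp add: norm_vec_def L2_set_def sum_4)

lemma norm_vec4_le: "norm (vec4 x1 x2 x3 x4) \<le> \<bar>x1\<bar> + \<bar>x2\<bar> + \<bar>x3\<bar> + \<bar>x4\<bar>"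
proof -
  have "norm (vec4 x1 x2 x3 x4) \<le> (\<Sum>i\<in>UNIV. \<bar>vec4 x1 x2 x3 x4 $ i\<bar>)"
    by (rule norm_le_l1_cart)
  then show ?thesis
    by (simp add: sum_4)
qed

lemma norm_jet_sq:
  "(norm (jet \<psi> v x))\<^sup>2 = ((\<psi> x)\<^sup>2 + (wd \<psi> x)\<^sup>2 + (wd (wd \<psi>) x)\<^sup>2) + ((v x)\<^sup>2 + (wd v x)\<^sup>2 + (wd (wd v) x)\<^sup>2)"
  by (simp add: jet_def norm_Pair norm_vec4_sq)

lemma H2_norm_integrand:
  assumes "H2 u"
  shows "integrable lborel (\<lambda>x. (u x)\<^sup>2 + (wd u x)\<^sup>2 + (wd (wd u) x)\<^sup>2)"
  using H2D(1-3)[OF assms] unfolding sq_int_def by auto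

lemma integral_norm_jet_sq:
  assumes "H2 \<psi>" "H2 v"
  shows "integrable lborel (\<lambda>x. (norm (jet \<psi> v x))\<^sup>2)" "(LINT x|lborel. (norm (jet \<psi> v x))\<^sup>2) = (X_norm \<psi> v)\<^sup>2"
proof -
  show "integrable lborel (\<lambda>x. (norm (jet \<psi> v x))\<^sup>2)"
    unfolding norm_jet_sq by (intro Bochner_Integration.integrable_add H2_norm_integrand assms)
  have "(LINT x|lborel. (norm (jet \<psi> v x))\<^sup>2) = H2_norm_sq \<psi> + H2_norm_sq v"
    unfolding norm_jet_sq H2_norm_sq_def
    by (intro Bochner_Integration.integral_add H2_norm_integrand assms)
  moreover have "0 \<le> H2_norm_sq \<psi> + H2_norm_sq v"
    unfolding H2_norm_sq_def by (intro add_nonneg_nonneg integral_nonneg_AE) auto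
  ultimately show "(LINT x|lborel. (norm (jet \<psi> v x))\<^sup>2) = (X_norm \<psi> v)\<^sup>2"
    by (simp add: X_norm_def)
qed

text \<open>The constant is chosen before the pair, so all perturbations from a bounded set of X
  have their first components in one common ball.\<close>

lemma jet_essentially_bounded:
  obtains C where "C > 0" "\<And>\<psi> v. H2 \<psi> \<Longrightarrow> H2 v \<Longrightarrow>
    AE x in lborel. norm (fst (jet \<psi> v x)) \<le> C * (2 + (X_norm \<psi> v)\<^sup>2)"
proof -
  obtain C where C: "C > 0" "\<And>u u1. weak_deriv u u1 \<Longrightarrow> sq_int u \<Longrightarrow> sq_int u1 \<Longrightarrow>
      AE x in lborel. \<bar>u x\<bar> \<le> C * (2 + (LINT x|lborel. (u x)\<^sup>2) + (LINT x|lborel. (u1 x)\<^sup>2))"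
    using H1_essentially_bounded by blast
  show thesis
  \<comment> \<open>One \<open>C\<close> for each of the four entries, through the l1 bound on the
    norm.\<close>
  proof (rule that[of "4 * C"])
    fix \<psi> v assume H: "H2 \<psi>" "H2 v"
    let ?N = "(X_norm \<psi> v)\<^sup>2"
    have b: "AE x in lborel. \<bar>u x\<bar> \<le> C * (2 + ?N)"
      if u: "weak_deriv u u1" "sq_int u" "sq_int u1" and le: "\<And>x. (u x)\<^sup>2 + (u1 x)\<^sup>2 \<le> (norm (jet \<psi> v x))\<^sup>2" for u u1
    proof -
      have i: "integrable lborel (\<lambda>x. (u x)\<^sup>2)" "integrable lborel (\<lambda>x. (u1 x)\<^sup>2)"
        using u unfolding sq_int_def by auto
      then have "(LINT x|lborel. (u x)\<^sup>2) + (LINT x|lborel. (u1 x)\<^sup>2) = (LINT x|lborel. (u x)\<^sup>2 + (u1 x)\<^sup>2)"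
        by simp
      also have "\<dots> \<le> (LINT x|lborel. (norm (jet \<psi> v x))\<^sup>2)"
        using i integral_norm_jet_sq(1)[OF H] le by (intro integral_mono) auto
      finally have "(LINT x|lborel. (u x)\<^sup>2) + (LINT x|lborel. (u1 x)\<^sup>2) \<le> ?N"
        using integral_norm_jet_sq(2)[OF H] by simp
      then have "C * (2 + (LINT x|lborel. (u x)\<^sup>2) + (LINT x|lborel. (u1 x)\<^sup>2)) \<le> C * (2 + ?N)"
        using C(1) by (intro mult_left_mono) auto
      with C(2)[OF u] show ?thesis
        by (auto elim!: eventually_mono)
    qed
    note d = H2D[OF H(1)] H2D[OF H(2)]
    have "AE x in lborel. \<bar>\<psi> x\<bar> \<le> C * (2 + ?N)" "AE x in lborel. \<bar>wd \<psi> x\<bar> \<le> C * (2 + ?N)"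
      "AE x in lborel. \<bar>v x\<bar> \<le> C * (2 + ?N)" "AE x in lborel. \<bar>wd v x\<bar> \<le> C * (2 + ?N)"
      using b[OF d(4,1,2)] b[OF d(5,2,3)] b[OF d(9,6,7)] b[OF d(10,7,8)]
      by (simp_all add: norm_jet_sq)
    then show "AE x in lborel. norm (fst (jet \<psi> v x)) \<le> 4 * C * (2 + ?N)"
    proof eventually_elim
      case (elim x)
      then show ?case
        using norm_vec4_le[of "\<psi> x" "wd \<psi> x" "v x" "wd v x"] by (simp add: jet_def)
    qed
  qed (use C in simp)
qed

lemma admissible_jet:
  assumes "H2 \<psi>" "H2 v"
  shows "admissible lborel (jet \<psi> v)"
proof -
  note d = H2D[OF assms(1)] H2D[OF assms(2)]
  have m [measurable]: "\<psi> \<in> borel_measurable borel" "wd \<psi> \<in> borel_measurable borel" "wd (wd \<psi>) \<in> borel_measurable borel"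
    "v \<in> borel_measurable borel" "wd v \<in> borel_measurable borel" "wd (wd v) \<in> borel_measurable borel"
    using d by (auto simp: sq_int_def)
  have "jet \<psi> v \<in> borel_measurable borel"
    unfolding jet_def[abs_def] vec4_eq by measurable
  moreover obtain C where "C > 0" "AE x in lborel. norm (fst (jet \<psi> v x)) \<le> C * (2 + (X_norm \<psi> v)\<^sup>2)"
    using jet_essentially_bounded assms by metis
  ultimately show ?thesis
    unfolding admissible_def using integral_norm_jet_sq(1)[OF assms] by auto
qed

lemma jet_lincomb:
  assumes "H2 \<psi>" "H2 v" "H2 h" "H2 k"
  shows "AE x in lborel. jet (\<lambda>x. \<alpha> * \<psi> x + \<beta> * h x) (\<lambda>x. \<alpha> * v x + \<beta> * k x) x
    = \<alpha> *\<^sub>R jet \<psi> v x + \<beta> *\<^sub>R jet h k x"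
  using H2_lincomb(2,3)[OF assms(1,3), of \<alpha> \<beta>] H2_lincomb(2,3)[OF assms(2,4), of \<alpha> \<beta>]
  by eventually_elim (simp add: jet_def vec4_eq algebra_simps)

lemma wd_zero:
  assumes "H2 u" "AE x in lborel. u x = 0"
  shows "AE x in lborel. wd u x = 0" "AE x in lborel. wd (wd u) x = 0"
proof -
  have z: "weak_deriv (\<lambda>_. 0) (\<lambda>_. 0)"
    by (simp add: weak_deriv_def loc_integrable_def set_integrable_def)
  note d = H2D[OF assms(1)]
  have "AE x in lborel. 0 = u x"
    using assms(2) by eventually_elim simp
  then have "weak_deriv u (\<lambda>_. 0)"
    using weak_deriv_cong_AE[OF z] d(1) by (auto simp: sq_int_def)
  then show 1: "AE x in lborel. wd u x = 0"
    by (rule wd_AE_eq)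
  have "AE x in lborel. 0 = wd u x"
    using 1 by eventually_elim simp
  then have "weak_deriv (wd u) (\<lambda>_. 0)"
    using weak_deriv_cong_AE[OF z] d(2) by (auto simp: sq_int_def)
  then show "AE x in lborel. wd (wd u) x = 0"
    by (rule wd_AE_eq)
qed

lemma jet_zero:
  assumes "H2 \<psi>" "H2 v" "X_zero \<psi> v"
  shows "AE x in lborel. jet \<psi> v x = 0"
proof -
  have z: "AE x in lborel. \<psi> x = 0" "AE x in lborel. v x = 0"
    using assms(3) unfolding X_zero_def by auto
  from z wd_zero[OF assms(1) z(1)] wd_zero[OF assms(2) z(2)] show ?thesis
    by eventually_elim (simp add: jet_def vec4_eq zero_prod_def)
qed

lemma sq_int_mult:
  assumes "sq_int f" "sq_int g"
  shows "integrable lborel (\<lambda>x. f x * g x)"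
proof -
  have "integrable lborel (\<lambda>x. (1 * f x + 1 * g x)\<^sup>2 - (f x)\<^sup>2 - (g x)\<^sup>2)"
    using assms sq_int_lincomb[OF assms, of 1 1] unfolding sq_int_def
    by (intro Bochner_Integration.integrable_diff) auto
  moreover have "(\<lambda>x. (1 * f x + 1 * g x)\<^sup>2 - (f x)\<^sup>2 - (g x)\<^sup>2) = (\<lambda>x. 2 * (f x * g x))"
    by (simp add: power2_eq_square algebra_simps)
  ultimately show ?thesis
    by simp
qed

text \<open>Polarisation of the integrand of I_\<omega>: each mixed product is symmetrised, which
  turns the coefficient \<open>2 * \<omega>\<close> into \<omega>.\<close>

definition qform :: "real \<Rightarrow> real \<Rightarrow> real \<Rightarrow> real \<Rightarrow> real \<Rightarrow> real \<Rightarrow> real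
    \<Rightarrow> (real^4) \<times> real \<times> real \<Rightarrow> (real^4) \<times> real \<times> real \<Rightarrow> real" where
  "qform a a2 c c2 b b2 \<omega> z y =
     fst z $ 1 * fst y $ 1 - c * (fst z $ 2 * fst y $ 2) + c2 * (fst (snd z) * fst (snd y))
     + fst z $ 3 * fst y $ 3 - a * (fst z $ 4 * fst y $ 4) + a2 * (snd (snd z) * snd (snd y))
     - \<omega> * ((fst z $ 1 * fst y $ 3 + fst z $ 3 * fst y $ 1)
        + b * (fst z $ 2 * fst y $ 4 + fst z $ 4 * fst y $ 2)
        + b2 * (fst (snd z) * snd (snd y) + snd (snd z) * fst (snd y)))"

lemma bounded_bilinear_qform: "bounded_bilinear (qform a a2 c c2 b b2 \<omega>)"
  unfolding bilinear_conv_bounded_bilinear[symmetric] bilinear_def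
  by (auto intro!: linearI simp: qform_def algebra_simps)

lemma qform_sym: "qform a a2 c c2 b b2 \<omega> y z = qform a a2 c c2 b b2 \<omega> z y"
  by (simp add: qform_def algebra_simps)

lemma Iw_eq_integral_qform:
  assumes "H2 \<psi>" "H2 v"
  shows "Iw a a2 c c2 b b2 \<omega> \<psi> v = (LINT x|lborel. qform a a2 c c2 b b2 \<omega> (jet \<psi> v x) (jet \<psi> v x))"
proof -
  note d = H2D(1-3)[OF assms(1)] H2D(1-3)[OF assms(2)]
  have sq: "integrable lborel (\<lambda>x. (f x)\<^sup>2)" if "sq_int f" for f
    using that by (simp add: sq_int_def)
  have i1: "integrable lborel (\<lambda>x. (\<psi> x)\<^sup>2 - c * (wd \<psi> x)\<^sup>2 + c2 * (wd (wd \<psi>) x)\<^sup>2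
      + (v x)\<^sup>2 - a * (wd v x)\<^sup>2 + a2 * (wd (wd v) x)\<^sup>2)"
    using d sq by auto
  have i2: "integrable lborel (\<lambda>x. \<psi> x * v x + b * wd \<psi> x * wd v x + b2 * wd (wd \<psi>) x * wd (wd v) x)"
    using sq_int_mult[OF d(1,4)] sq_int_mult[OF d(2,5)] sq_int_mult[OF d(3,6)] by (simp add: mult.assoc)
  have "Iw a a2 c c2 b b2 \<omega> \<psi> v = (LINT x|lborel. ((\<psi> x)\<^sup>2 - c * (wd \<psi> x)\<^sup>2 + c2 * (wd (wd \<psi>) x)\<^sup>2
      + (v x)\<^sup>2 - a * (wd v x)\<^sup>2 + a2 * (wd (wd v) x)\<^sup>2)
      - 2 * \<omega> * (\<psi> x * v x + b * wd \<psi> x * wd v x + b2 * wd (wd \<psi>) x * wd (wd v) x))"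
    unfolding Iw_def I1_def I2_def using i1 i2 by simp
  also have "\<dots> = (LINT x|lborel. qform a a2 c c2 b b2 \<omega> (jet \<psi> v x) (jet \<psi> v x))"
    by (intro Bochner_Integration.integral_cong)
      (simp_all add: qform_def jet_def power2_eq_square algebra_simps)
  finally show ?thesis .
qed

lemma binary_form_pos:
  fixes x y A D m :: real
  assumes "\<bar>m\<bar> < A" "\<bar>m\<bar> < D"
  shows "0 \<le> A * x\<^sup>2 + D * y\<^sup>2 - 2 * m * (x * y)"
    and "A * x\<^sup>2 + D * y\<^sup>2 - 2 * m * (x * y) = 0 \<Longrightarrow> x = 0 \<and> y = 0"
proof -
  have "2 * \<bar>x * y\<bar> \<le> x\<^sup>2 + y\<^sup>2"
    using sum_squares_bound[of "\<bar>x\<bar>" "\<bar>y\<bar>"] by (simp add: abs_mult)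
  then have "\<bar>m\<bar> * (2 * \<bar>x * y\<bar>) \<le> \<bar>m\<bar> * (x\<^sup>2 + y\<^sup>2)"
    by (intro mult_left_mono) auto
  moreover have "2 * m * (x * y) \<le> \<bar>m\<bar> * (2 * \<bar>x * y\<bar>)"
    using abs_ge_self[of "2 * m * (x * y)"] by (simp add: abs_mult mult_ac)
  ultimately have le: "(A - \<bar>m\<bar>) * x\<^sup>2 + (D - \<bar>m\<bar>) * y\<^sup>2 \<le> A * x\<^sup>2 + D * y\<^sup>2 - 2 * m * (x * y)"
    by (simp add: algebra_simps)
  have nn: "0 \<le> (A - \<bar>m\<bar>) * x\<^sup>2" "0 \<le> (D - \<bar>m\<bar>) * y\<^sup>2"
    using assms by auto
  with le show "0 \<le> A * x\<^sup>2 + D * y\<^sup>2 - 2 * m * (x * y)"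
    by linarith
  assume "A * x\<^sup>2 + D * y\<^sup>2 - 2 * m * (x * y) = 0"
  with le nn have "(A - \<bar>m\<bar>) * x\<^sup>2 = 0" "(D - \<bar>m\<bar>) * y\<^sup>2 = 0"
    by linarith+
  with assms show "x = 0 \<and> y = 0"
    by auto
qed

text \<open>On the diagonal the form decouples into three binary forms, one for each order of
  differentiation, with mixed coefficients \<omega>, \<open>\<omega> * b\<close> and
  \<open>\<omega> * b2\<close>. The entries of the minimum are exactly the conditions that each
  diagonal coefficient dominates the mixed one.\<close>

lemma qform_pos:
  fixes z :: "(real^4) \<times> real \<times> real"
  assumes "b > 0" "b2 > 0" "\<bar>\<omega>\<bar> < Min {1, -a / b, -c / b, a2 / b2, c2 / b2}"
  shows "0 \<le> qform a a2 c c2 b b2 \<omega> z z" and "qform a a2 c c2 b b2 \<omega> z z = 0 \<Longrightarrow> z = 0"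
proof -
  have w: "\<bar>\<omega>\<bar> < 1" "\<bar>\<omega> * b\<bar> < - a" "\<bar>\<omega> * b\<bar> < - c" "\<bar>\<omega> * b2\<bar> < a2" "\<bar>\<omega> * b2\<bar> < c2"
    using assms pos_less_divide_eq[of b "\<bar>\<omega>\<bar>" "- a"] pos_less_divide_eq[of b "\<bar>\<omega>\<bar>" "- c"]
    by (auto simp: abs_mult pos_less_divide_eq)
  note p1 = binary_form_pos[OF w(1) w(1), of "fst z $ 1" "fst z $ 3"]
  note p2 = binary_form_pos[OF w(3) w(2), of "fst z $ 2" "fst z $ 4"]
  note p3 = binary_form_pos[OF w(5) w(4), of "fst (snd z)" "snd (snd z)"]
  have eq: "qform a a2 c c2 b b2 \<omega> z z =
      (1 * (fst z $ 1)\<^sup>2 + 1 * (fst z $ 3)\<^sup>2 - 2 * \<omega> * (fst z $ 1 * fst z $ 3))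
      + (- c * (fst z $ 2)\<^sup>2 + - a * (fst z $ 4)\<^sup>2 - 2 * (\<omega> * b) * (fst z $ 2 * fst z $ 4))
      + (c2 * (fst (snd z))\<^sup>2 + a2 * (snd (snd z))\<^sup>2 - 2 * (\<omega> * b2) * (fst (snd z) * snd (snd z)))"
    by (simp add: qform_def power2_eq_square algebra_simps)
  show "0 \<le> qform a a2 c c2 b b2 \<omega> z z"
    unfolding eq using p1(1) p2(1) p3(1) by linarith
  assume "qform a a2 c c2 b b2 \<omega> z z = 0"
  then have "fst z $ 1 = 0 \<and> fst z $ 3 = 0" "fst z $ 2 = 0 \<and> fst z $ 4 = 0" "fst (snd z) = 0 \<and> snd (snd z) = 0"
    unfolding eq using p1 p2 p3 by linarith+
  then have "fst z = 0" "snd z = 0"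
    by (simp_all add: vec_eq_iff forall_4 prod_eq_iff)
  then show "z = 0"
    by (simp add: prod_eq_iff)
qed

section \<open>Transfer of the abstract descent argument to the minimising pair\<close>

theorem theorem2p5:
  fixes a c a2 c2 b b2 \<omega> :: real
    and F :: "real^4 \<Rightarrow> real"
    and \<psi>0 v0 :: "real \<Rightarrow> real"
  assumes "a < 0" "c < 0" "a2 > 0" "c2 > 0" "b > 0" "b2 > 0"
    and "0 < \<bar>\<omega>\<bar>"
    and "\<bar>\<omega>\<bar> < Min {1, -a / b, -c / b, a2 / b2, c2 / b2}"
    and "C2_R4 F" and "F 0 = 0"
    and cond_a: "\<exists>p>0. \<forall>w. w \<bullet> grad (Gfun F) w \<ge> (p + 2) * Gfun F w"
    and cond_b: "\<exists>q1 q2 C. 0 < q1 \<and> q1 \<le> q2 \<and> C > 0 \<and>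
                   (\<forall>w. norm (hess F w) \<le> C * (norm w powr q1 + norm w powr q2))"
    and cond_c: "\<exists>u v. H2 u \<and> H2 v \<and>
                   (LINT x|lborel. F (vec4 (u x) (wd u x) (v x) (wd v x))) > 0"
    and "H2 \<psi>0" "H2 v0"
    and "Pw a a2 c c2 b b2 \<omega> F \<psi>0 v0 = 0"
    and "Jw a a2 c c2 b b2 \<omega> F \<psi>0 v0 = Sw a a2 c c2 b b2 \<omega> F"
  shows "Jw_critical a a2 c c2 b b2 \<omega> F \<psi>0 v0"
proof -
  obtain p where p: "p > 0" "\<And>w. w \<bullet> grad (Gfun F) w \<ge> (p + 2) * Gfun F w"
    using cond_a by blast
  let ?B = "qform a a2 c c2 b b2 \<omega>"
  note B_pos = qform_pos[OF \<open>b > 0\<close> \<open>b2 > 0\<close> \<open>\<bar>\<omega>\<bar> < Min _\<close>]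
  interpret N: nehari ?B F "grad F" p
  proof (rule nehari.intro)
    show "bounded_bilinear ?B"
      by (rule bounded_bilinear_qform)
    show "?B y z = ?B z y" for y z
      by (rule qform_sym)
    show "t powr (p + 2) * (w \<bullet> grad F w) \<le> (t *\<^sub>R w) \<bullet> grad F (t *\<^sub>R w)" if "t \<ge> 1" for t w
      using Gfun_scaling[OF \<open>C2_R4 F\<close> p(2) that, of w] unfolding Gfun_def .
  qed (use \<open>F 0 = 0\<close> p B_pos(1) grad_zero[OF \<open>C2_R4 F\<close> p(2,1)] F_has_derivative[OF \<open>C2_R4 F\<close>]
      grad_Lipschitz[OF \<open>C2_R4 F\<close>] in auto)
  have J: "Jw a a2 c c2 b b2 \<omega> F \<psi> v = (LINT x|lborel. N.j (jet \<psi> v x))" if "H2 \<psi>" "H2 v" for \<psi> v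
    using N.integrable_B[OF admissible_jet[OF that]] N.integrable_F[OF admissible_jet[OF that]]
    by (simp add: Jw_def Iw_eq_integral_qform[OF that] Kfun_def N.j_def) (simp add: jet_def)
  have P: "Pw a a2 c c2 b b2 \<omega> F \<psi> v = (LINT x|lborel. N.q (jet \<psi> v x))" if "H2 \<psi>" "H2 v" for \<psi> v
    using N.integrable_B[OF admissible_jet[OF that]] N.integrable_G[OF admissible_jet[OF that]]
    by (simp add: Pw_def Iw_eq_integral_qform[OF that] Nfun_def N.q_def) (simp add: jet_def N.G_def Gfun_def)
  define Z where "Z = jet \<psi>0 v0"
  have Z: "admissible lborel Z"
    unfolding Z_def using \<open>H2 \<psi>0\<close> \<open>H2 v0\<close> by (rule admissible_jet)
  have [measurable]: "Z \<in> borel_measurable borel"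
    using Z by (simp add: admissible_def)
  \<comment> \<open>Combining functions and combining jets differ on a null set only, so the
    abstract combinations of jets are realised by actual pairs in X.\<close>
  have Jcomb: "Jw a a2 c c2 b b2 \<omega> F (\<lambda>x. \<alpha> * \<psi>0 x + \<beta> * h x) (\<lambda>x. \<alpha> * v0 x + \<beta> * k x)
      = (LINT x|lborel. N.j (\<alpha> *\<^sub>R Z x + \<beta> *\<^sub>R jet h k x))" (is "?J")
    and Pcomb: "Pw a a2 c c2 b b2 \<omega> F (\<lambda>x. \<alpha> * \<psi>0 x + \<beta> * h x) (\<lambda>x. \<alpha> * v0 x + \<beta> * k x)
      = (LINT x|lborel. N.q (\<alpha> *\<^sub>R Z x + \<beta> *\<^sub>R jet h k x))" (is "?P")
    if hk: "H2 h" "H2 k" for h k \<alpha> \<beta>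
  proof -
    let ?\<psi> = "\<lambda>x. \<alpha> * \<psi>0 x + \<beta> * h x" and ?v = "\<lambda>x. \<alpha> * v0 x + \<beta> * k x"
    have H: "H2 ?\<psi>" "H2 ?v"
      using H2_lincomb(1) hk \<open>H2 \<psi>0\<close> \<open>H2 v0\<close> by auto
    note eq = jet_lincomb[OF \<open>H2 \<psi>0\<close> \<open>H2 v0\<close> hk, of \<alpha> \<beta>, folded Z_def]
    note adm = admissible_jet[OF H] admissible_lincomb[OF Z admissible_jet[OF hk], of \<alpha> \<beta>]
    show ?J
      unfolding J[OF H]
      by (rule integral_cong_AE)
        (use eq N.integrable_j[OF adm(1)] N.integrable_j[OF adm(2)] in \<open>auto elim!: eventually_mono\<close>)
    show ?P
      unfolding P[OF H]
      by (rule integral_cong_AE)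
        (use eq integrable_quadratically_bounded[OF N.quadratically_bounded_q adm(1)]
          integrable_quadratically_bounded[OF N.quadratically_bounded_q adm(2)] in \<open>auto elim!: eventually_mono\<close>)
  qed
  have qZ: "(LINT x|lborel. N.q (Z x)) = 0"
    using P[OF \<open>H2 \<psi>0\<close> \<open>H2 v0\<close>] \<open>Pw _ _ _ _ _ _ _ _ _ _ = 0\<close> by (simp add: Z_def)
  have no_descent: "0 \<le> (LINT x|lborel. N.dj (Z x) (jet h k x))" if hk: "H2 h" "H2 k" for h k
  proof (cases "(LINT x|lborel. ?B (Z x) (Z x)) = 0")
    \<comment> \<open>The trivial pair: the form is definite, so the jet vanishes almost everywhere,
      and the derivative of J at 0 is zero because the gradient of F vanishes there.\<close>
    case True
    then have "AE x in lborel. ?B (Z x) (Z x) = 0"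
      using integral_nonneg_eq_0_iff_AE[OF N.integrable_B[OF Z]] B_pos(1) by simp
    then have "AE x in lborel. N.dj (Z x) (jet h k x) = 0"
    proof eventually_elim
      case (elim x)
      then have "Z x = 0"
        by (rule B_pos(2))
      then show ?case
        by (simp add: N.dj_def N.DF0 qform_def)
    qed
    then show ?thesis
      by (subst integral_eq_zero_AE) auto
  next
    case False
    moreover have "0 \<le> (LINT x|lborel. ?B (Z x) (Z x))"
      by (intro integral_nonneg_AE AE_I2 B_pos(1))
    ultimately have pos: "0 < (LINT x|lborel. ?B (Z x) (Z x))"
      by linarith
    show ?thesis
    proof (rule ccontr)
      assume "\<not> ?thesis"
      then have L: "(LINT x|lborel. N.dj (Z x) (jet h k x)) < 0"
        by simp
      let ?Y = "jet h k"
      obtain t s r where t: "t > 0" and q: "(LINT x|lborel. N.q (t *\<^sub>R Z x + (t * s) *\<^sub>R ?Y x)) = 0"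
        and less: "(LINT x|lborel. N.j (t *\<^sub>R Z x + (t * s) *\<^sub>R ?Y x)) < (LINT x|lborel. N.j (Z x))"
        and r: "(LINT x|lborel. N.q (r *\<^sub>R Z x + (r * s) *\<^sub>R ?Y x)) \<noteq> 0"
        by (rule N.descent_on_manifold[OF Z qZ pos admissible_jet[OF hk] L])
      let ?\<psi> = "\<lambda>x. t * \<psi>0 x + (t * s) * h x" and ?v = "\<lambda>x. t * v0 x + (t * s) * k x"
      have H: "H2 ?\<psi>" "H2 ?v"
        using H2_lincomb(1) hk \<open>H2 \<psi>0\<close> \<open>H2 v0\<close> by auto
      \<comment> \<open>If the competitor were zero, then so would \<open>Z + s Y\<close> be, since
        \<open>t > 0\<close>; this contradicts the nonzero value of \<open>q\<close> at the multiple
        \<open>r\<close>.\<close>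
      have "\<not> X_zero ?\<psi> ?v"
      proof
        assume "X_zero ?\<psi> ?v"
        then have "AE x in lborel. jet ?\<psi> ?v x = 0"
          by (rule jet_zero[OF H])
        with jet_lincomb[OF \<open>H2 \<psi>0\<close> \<open>H2 v0\<close> hk, of t "t * s", folded Z_def]
        have "AE x in lborel. N.q (r *\<^sub>R Z x + (r * s) *\<^sub>R ?Y x) = 0"
        proof eventually_elim
          case (elim x)
          then have "t *\<^sub>R (Z x + s *\<^sub>R ?Y x) = 0"
            by (simp add: scaleR_add_right)
          then have "Z x + s *\<^sub>R ?Y x = 0"
            using t by simp
          moreover have "r *\<^sub>R Z x + (r * s) *\<^sub>R ?Y x = r *\<^sub>R (Z x + s *\<^sub>R ?Y x)"
            by (simp add: scaleR_add_right)
          ultimately show ?case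
            by (simp add: N.q_def N.G_def qform_def)
        qed
        then show False
          using r by (subst (asm) integral_eq_zero_AE) auto
      qed
      \<comment> \<open>\<open>Inf\<close> on the reals is a lower bound only for sets bounded
        below, so this is needed before the competitor can be compared with
        \<open>Sw\<close>.\<close>
      moreover have "bdd_below {Jw a a2 c c2 b b2 \<omega> F \<psi> v | \<psi> v.
          H2 \<psi> \<and> H2 v \<and> Pw a a2 c c2 b b2 \<omega> F \<psi> v = 0 \<and> \<not> X_zero \<psi> v}"
        by (rule bdd_belowI[of _ 0]) (auto simp: J P intro!: N.integral_j_nonneg admissible_jet)
      ultimately have "Sw a a2 c c2 b b2 \<omega> F \<le> Jw a a2 c c2 b b2 \<omega> F ?\<psi> ?v"
        unfolding Sw_def using H q Pcomb[OF hk, of t "t * s"] by (intro cInf_lower) auto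
      then show False
        using less \<open>Jw _ _ _ _ _ _ _ _ _ _ = Sw _ _ _ _ _ _ _ _\<close> J[OF \<open>H2 \<psi>0\<close> \<open>H2 v0\<close>] Jcomb[OF hk, of t "t * s"]
        by (simp add: Z_def)
    qed
  qed
  \<comment> \<open>Reversing the direction gives the opposite inequality. The negatives are written
    as linear combinations so that \<open>H2_lincomb\<close> and \<open>jet_lincomb\<close>
    apply.\<close>
  have crit: "(LINT x|lborel. N.dj (Z x) (jet h k x)) = 0" if hk: "H2 h" "H2 k" for h k
  proof -
    have nh: "H2 (\<lambda>x. - 1 * h x + 0 * h x)" "H2 (\<lambda>x. - 1 * k x + 0 * k x)"
      using H2_lincomb(1) hk by blast+
    have "AE x in lborel. N.dj (Z x) (jet (\<lambda>x. - 1 * h x + 0 * h x) (\<lambda>x. - 1 * k x + 0 * k x) x)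
        = - N.dj (Z x) (jet h k x)"
      using jet_lincomb[OF hk hk, of "-1" 0]
    proof eventually_elim
      case (elim x)
      then show ?case
        unfolding elim by (simp add: N.dj_def qform_def algebra_simps)
    qed
    then have "(LINT x|lborel. N.dj (Z x) (jet (\<lambda>x. - 1 * h x + 0 * h x) (\<lambda>x. - 1 * k x + 0 * k x) x))
        = (LINT x|lborel. - N.dj (Z x) (jet h k x))"
      using N.integrable_dj[OF Z admissible_jet[OF nh]] N.integrable_dj[OF Z admissible_jet[OF hk]]
      by (intro integral_cong_AE) auto
    then show ?thesis
      using no_descent[OF hk] no_descent[OF nh] by simp
  qed
  obtain CS where CS: "CS > 0" "\<And>\<psi> v. H2 \<psi> \<Longrightarrow> H2 v \<Longrightarrow>
    AE x in lborel. norm (fst (jet \<psi> v x)) \<le> CS * (2 + (X_norm \<psi> v)\<^sup>2)"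
    using jet_essentially_bounded by blast
  obtain R0 where R0: "R0 \<ge> 0" "AE x in lborel. norm (fst (Z x)) \<le> R0"
    by (rule admissible_bound[OF Z])
  \<comment> \<open>For a perturbation of norm below 1 the jet bound
    \<open>CS * (2 + (X_norm h k)\<^sup>2)\<close> is at most \<open>3 * CS\<close>.\<close>
  define R where "R = R0 + 3 * CS"
  have "R \<ge> 0"
    using R0 CS by (simp add: R_def)
  then obtain C where C: "C \<ge> 0" "\<And>z0 z y. norm (fst z0) \<le> R \<Longrightarrow> norm (fst z) \<le> R \<Longrightarrow> norm (fst y) \<le> R \<Longrightarrow>
      \<bar>N.j (z + y) - N.j z - N.dj z0 y\<bar> \<le> C * norm y * (norm (z - z0) + norm y)"
    using N.j_linearisation by blast
  have ZR: "AE x in lborel. norm (fst (Z x)) \<le> R"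
    using R0(2) by eventually_elim (use CS in \<open>simp add: R_def\<close>)
  \<comment> \<open>Base point and linearisation point coincide and the linear term vanishes by
    \<open>crit\<close>, so the whole increment is quadratic.\<close>
  have est: "\<bar>Jw a a2 c c2 b b2 \<omega> F (\<lambda>x. \<psi>0 x + h x) (\<lambda>x. v0 x + k x) - Jw a a2 c c2 b b2 \<omega> F \<psi>0 v0\<bar>
      \<le> C * (X_norm h k)\<^sup>2" if hk: "H2 h" "H2 k" and small: "X_norm h k < 1" "0 \<le> X_norm h k" for h k
  proof -
    have "(X_norm h k)\<^sup>2 \<le> 1"
      using small by (simp add: power_le_one)
    then have "CS * (2 + (X_norm h k)\<^sup>2) \<le> CS * 3"
      using CS(1) by (intro mult_left_mono) auto
    then have YR: "AE x in lborel. norm (fst (jet h k x)) \<le> R"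
      using CS(2)[OF hk] R0(1) by (auto simp: R_def elim!: eventually_mono)
    have "\<bar>(LINT x|lborel. N.j (Z x + jet h k x)) - (LINT x|lborel. N.j (Z x)) - (LINT x|lborel. N.dj (Z x) (jet h k x))\<bar>
        \<le> C * (LINT x|lborel. norm (jet h k x) * norm (Z x - Z x)) + C * (LINT x|lborel. (norm (jet h k x))\<^sup>2)"
      by (rule N.integral_j_linearisation[OF Z ZR Z ZR admissible_jet[OF hk] YR C(2)])
    then show ?thesis
      using Jcomb[OF hk, of 1 1] J[OF \<open>H2 \<psi>0\<close> \<open>H2 v0\<close>] crit[OF hk] integral_norm_jet_sq(2)[OF hk]
      by (simp add: Z_def)
  qed
  show ?thesis
    unfolding Jw_critical_def
  proof (intro allI impI)
    fix \<epsilon> :: real assume \<epsilon>: "\<epsilon> > 0"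
    show "\<exists>\<delta>>0. \<forall>h k. H2 h \<and> H2 k \<and> X_norm h k < \<delta> \<longrightarrow>
        \<bar>Jw a a2 c c2 b b2 \<omega> F (\<lambda>x. \<psi>0 x + h x) (\<lambda>x. v0 x + k x) - Jw a a2 c c2 b b2 \<omega> F \<psi>0 v0\<bar>
          \<le> \<epsilon> * X_norm h k"
    \<comment> \<open>The 1 keeps the perturbation in the range of \<open>est\<close>;
      \<open>C + 1\<close> rather than \<open>C\<close> because \<open>C\<close> may be 0.\<close>
    proof (intro exI[of _ "min 1 (\<epsilon> / (C + 1))"] conjI allI impI)
      show "0 < min 1 (\<epsilon> / (C + 1))"
        using \<epsilon> C(1) by simp
      fix h k assume hk: "H2 h \<and> H2 k \<and> X_norm h k < min 1 (\<epsilon> / (C + 1))"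
      then have nn: "0 \<le> X_norm h k"
        unfolding X_norm_def H2_norm_sq_def
        by (intro real_sqrt_ge_zero add_nonneg_nonneg integral_nonneg_AE) auto
      have "X_norm h k * (C + 1) \<le> \<epsilon>"
        using hk C(1) by (simp add: pos_less_divide_eq)
      then have "C * X_norm h k \<le> \<epsilon>"
        using nn by (simp add: algebra_simps)
      then have "C * X_norm h k * X_norm h k \<le> \<epsilon> * X_norm h k"
        using nn by (rule mult_right_mono)
      moreover have "\<bar>Jw a a2 c c2 b b2 \<omega> F (\<lambda>x. \<psi>0 x + h x) (\<lambda>x. v0 x + k x) - Jw a a2 c c2 b b2 \<omega> F \<psi>0 v0\<bar>
          \<le> C * (X_norm h k)\<^sup>2"
        using hk nn by (intro est) auto
      ultimately show "\<bar>Jw a a2 c c2 b b2 \<omega> F (\<lambda>x. \<psi>0 x + h x) (\<lambda>x. v0 x + k x) - Jw a a2 c c2 b b2 \<omega> F \<psi>0 v0\<bar>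
          \<le> \<epsilon> * X_norm h k"
        by (simp add: power2_eq_square mult.assoc)
    qed
  qed
qed

end
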